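(* Let $B$ be an $\mathbb{F}_1^{\pm}$-algebra and $n\ge 0$ an integer. Then there are isomorphisms of ordered blue $B$-modules $$B\xrightarrow{\ \sim\ }\textstyle\bigwedge^0 B^n,\qquad B^n\xrightarrow{\ \sim\ }\bigwedge^1 B^n,\qquad 0\xrightarrow{\ \sim\ }\bigwedge^k B^n\quad\text{for } k\ge n+1,$$ and $(\bigwedge B^n)^+$ is generated by $(\bigwedge^1 B^n)^+$ as a $B^+$-algebra.
   Context: **Ordered blueprints.** Semirings are commutative with $0$ and $1$ unless otherwise stated. An ordered semiring is a semiring with a partial order compatible with addition and multiplication ($a\le b$ implies $a+z\le b+z$ and $az\le bz$). An ordered blueprint is $B=(B^\bullet,B^+,\le)$ where $(B^+,\le)$ is an ordered semiring and $B^\bullet\subseteq B^+$ is a multiplicative submonoid containing $0$ and $1$ such that every element of $B^+$ is a finite sum of elements of $B^\bullet$. An $\mathbb{F}_1^{\pm}$-algebra is an ordered blueprint $B$ with a distinguished element $\epsilon\in B^\bullet$ such that $\epsilon^2=1$ and $0\le 1+\epsilon$. **$B$-modules.** An (ordered blue) $B$-module is $M=(M^\bullet,M^+,\le)$ where $M^+$ is a $B^+$-(semi)module, $\le$ is a partial order on $M^+$ compatible with addition and such that $b_1\le b_2$, $m_1\le m_2$ imply $b_1m_1\le b_2m_2$, and $M^\bullet\subseteq M^+$ contains $0$, is stable under $B^\bullet$, and generates $M^+$ as a semigroup (finite sums). A morphism $M\to N$ of $B$-modules is an order-preserving $B^+$-linear map $M^+\to N^+$ sending $M^\bullet$ into $N^\bullet$.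 $B$ itself is a $B$-module; $B^n=((B^\bullet)^n,(B^+)^n,\le)$ with the coordinatewise order, and $e_1,\dots,e_n$ is its canonical basis. $[n]=\{1,\dots,n\}$, and $\binom{[n]}{d}$ is the set of $d$-element subsets of $[n]$. **Tensor algebra.** $M_1\otimes_B M_2$ is the following $B$-module. Start with the tensor product $M_1^+\otimes_{B^+}M_2^+$ of semimodules (universal for $B^+$-bilinear maps). Let $\mathfrak r$ be the smallest preorder on it that is compatible with addition, satisfies $b_1 m_1\le_{\mathfrak r} b_2m_2$ whenever $b_1\le b_2$ and $m_1\le_{\mathfrak r} m_2$, and contains $x_1\otimes y_1\le x_2\otimes y_2$ whenever $x_1\le x_2$ and $y_1\le y_2$. Then $(M_1\otimes_BM_2)^+$ is the quotient by the equivalence "$x\le_{\mathfrak r} y$ and $y\le_{\mathfrak r} x$", with the induced partial order, and its underlying set consists of the classes of $m_1\otimes m_2$ with $m_i\in M_i^\bullet$. Put $T(B^n)=\bigoplus_{l\ge0}(B^n)^{\otimes l}$ with $(B^n)^{\otimes 0}=B$: the ambient module is the direct sum of the $((B^n)^{\otimes l})^+$ with componentwise order, and the underlying set is the union of the images of the $((B^n)^{\otimes l})^\bullet$. Concatenation of tensors makes it a (typically non-commutative) $B$-algebra. **Exterior algebra.** Let $\tau_n=\{e_i\otimes e_i\equiv 0: i\in[n]\}\cup\{e_i\otimes e_j\equiv\epsilon\, e_j\otimes e_i: i\ne j\}$. Let $\langle\tau_n\rangle$ be the smallest preorder on $T(B^n)^+$ that is compatible with addition and with left and right multiplication, contains the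 order of $T(B^n)$, and contains $(x,y)$ and $(y,x)$ for every $x\equiv y$ in $\tau_n$. Let $A_n$ be the quotient of $T(B^n)^+$ by the equivalence "$(x,y)\in\langle\tau_n\rangle$ and $(y,x)\in\langle\tau_n\rangle$", with the partial order induced by $\langle\tau_n\rangle$ and the induced product, written $\wedge$. For $I=\{i_1<\dots<i_d\}\subseteq[n]$ let $e_I\in A_n$ be the class of $e_{i_1}\otimes\cdots\otimes e_{i_d}$ (so $e_\emptyset=1$). Let $H_{d,n}=\{\sum_{I\in\binom{[n]}{d}}b_Ie_I : b_I\in B^\bullet\}\subseteq A_n$ and let $S_{d,n}$ be the $B^+$-submodule of $A_n$ generated by $H_{d,n}$ (both are $\{0\}$ if $d>n$). The $d$-th exterior power is the $B$-module $\bigwedge^dB^n=(H_{d,n},S_{d,n},\le)$ with the order induced from $A_n$. The exterior algebra is the $B$-module $\bigwedge B^n=(\bigcup_{l=0}^nH_{l,n},A_n,\le)$; its ambient module $(\bigwedge B^n)^+=A_n$ is a (typically non-commutative) $B^+$-algebra. *)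

theory Defs
  imports "HOL-Library.Multiset" "HOL-Algebra.Module"
begin

section \<open>Ordered blueprints\<close>

text \<open>
  An ordered blueprint $B = (B^\bullet, B^+, \le)$ is given by a type \<open>'a\<close> carrying the ambient
  ordered semiring $(B^+, \le)$ and a set \<open>Bp :: 'a set\<close> playing the role of $B^\bullet$. The
  class does not extend \<^class>\<open>comm_semiring_1\<close>, as this would exclude the semiring with
  $0 = 1$. It does not extend the library's ordered semirings either: there, multiplication is only
  monotone for nonnegative factors.
\<close>

class ord_comm_semiring = comm_semiring_0 + comm_monoid_mult + ordered_ab_semigroup_add +
  assumes mult_right_mono_all: "a \<le> b \<Longrightarrow> a * z \<le> b * z"

locale ordered_blueprint =
  fixes Bp :: "'a::ord_comm_semiring set"
  assumes zero_mem: "0 \<in> Bp"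
    and one_mem: "1 \<in> Bp"
    and mult_mem: "a \<in> Bp \<Longrightarrow> b \<in> Bp \<Longrightarrow> a * b \<in> Bp"
    and generates: "\<exists>as. set as \<subseteq> Bp \<and> x = sum_list as"

locale F1pm_algebra = ordered_blueprint Bp for Bp :: "'a::ord_comm_semiring set" +
  fixes eps :: 'a
  assumes eps_mem: "eps \<in> Bp"
    and eps_square: "eps ^ 2 = 1"
    and zero_le_one_plus_eps: "0 \<le> 1 + eps"


section \<open>Modules over an ordered blueprint\<close>

text \<open>
  The module record of the library is extended by the underlying set \<open>pts\<close> and the order \<open>leq\<close>;
  the carrier is the ambient semimodule. The fields \<open>mult\<close> and \<open>one\<close> are relevant
  only for algebras and are \<^const>\<open>undefined\<close> in plain modules.
\<close>

record ('a, 'm) blue_struct = "('a, 'm) module" +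
  pts :: "'m set"
  leq :: "'m \<Rightarrow> 'm \<Rightarrow> bool"

locale blue_module = ordered_blueprint Bp + abelian_monoid M
  for Bp :: "'a::ord_comm_semiring set" and M :: "('a, 'm) blue_struct" (structure) +
  assumes smult_closed: "x \<in> carrier M \<Longrightarrow> b \<odot> x \<in> carrier M"
    and smult_add_left: "x \<in> carrier M \<Longrightarrow> (b + c) \<odot> x = b \<odot> x \<oplus> c \<odot> x"
    and smult_add_right:
      "x \<in> carrier M \<Longrightarrow> y \<in> carrier M \<Longrightarrow> b \<odot> (x \<oplus> y) = b \<odot> x \<oplus> b \<odot> y"
    and smult_smult: "x \<in> carrier M \<Longrightarrow> (b * c) \<odot> x = b \<odot> (c \<odot> x)"
    and one_smult: "x \<in> carrier M \<Longrightarrow> 1 \<odot> x = x"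
    and zero_smult: "x \<in> carrier M \<Longrightarrow> 0 \<odot> x = \<zero>"
    and smult_zero: "b \<odot> \<zero> = \<zero>"
    and leq_refl: "reflp_on (carrier M) (leq M)"
    and leq_antisym: "antisymp_on (carrier M) (leq M)"
    and leq_trans: "transp_on (carrier M) (leq M)"
    and leq_add:
      "x \<in> carrier M \<Longrightarrow> y \<in> carrier M \<Longrightarrow> z \<in> carrier M \<Longrightarrow> leq M x y
        \<Longrightarrow> leq M (x \<oplus> z) (y \<oplus> z)"
    and leq_smult:
      "x \<in> carrier M \<Longrightarrow> y \<in> carrier M \<Longrightarrow> b \<le> c \<Longrightarrow> leq M x y \<Longrightarrow> leq M (b \<odot> x) (c \<odot> y)"
    and pts_subset: "pts M \<subseteq> carrier M"
    and zero_pts: "\<zero> \<in> pts M"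
    and smult_pts: "b \<in> Bp \<Longrightarrow> x \<in> pts M \<Longrightarrow> b \<odot> x \<in> pts M"
    and pts_generate: "x \<in> carrier M \<Longrightarrow> \<exists>xs. set xs \<subseteq> pts M \<and> x = foldr (\<oplus>) xs \<zero>"

definition blue_hom :: "('a, 'm) blue_struct \<Rightarrow> ('a, 'k) blue_struct \<Rightarrow> ('m \<Rightarrow> 'k) set" where
  "blue_hom M N = {f \<in> carrier M \<rightarrow> carrier N.
     f \<zero>\<^bsub>M\<^esub> = \<zero>\<^bsub>N\<^esub> \<and>
     (\<forall>x\<in>carrier M. \<forall>y\<in>carrier M. f (x \<oplus>\<^bsub>M\<^esub> y) = f x \<oplus>\<^bsub>N\<^esub> f y) \<and>
     (\<forall>b. \<forall>x\<in>carrier M. f (b \<odot>\<^bsub>M\<^esub> x) = b \<odot>\<^bsub>N\<^esub> f x) \<and>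
     (\<forall>x\<in>carrier M. \<forall>y\<in>carrier M. leq M x y \<longrightarrow> leq N (f x) (f y)) \<and>
     f ` pts M \<subseteq> pts N}"

definition blue_isomorphic ::
  "'a::ord_comm_semiring set \<Rightarrow> ('a, 'm) blue_struct \<Rightarrow> ('a, 'k) blue_struct \<Rightarrow> bool" where
  "blue_isomorphic Bp M N \<longleftrightarrow> blue_module Bp M \<and> blue_module Bp N \<and>
     (\<exists>f \<in> blue_hom M N. \<exists>g \<in> blue_hom N M.
        (\<forall>x\<in>carrier M. g (f x) = x) \<and> (\<forall>y\<in>carrier N. f (g y) = y))"

definition base_module :: "'a::ord_comm_semiring set \<Rightarrow> ('a, 'a) blue_struct" where
  "base_module Bp =
     \<lparr>carrier = UNIV, mult = (*), one = 1, zero = 0, add = (+), smult = (*), pts = Bp, leq = (\<le>)\<rparr>"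

definition zero_module :: "('a, unit) blue_struct" where
  "zero_module =
     \<lparr>carrier = UNIV, mult = undefined, one = undefined, zero = (), add = (\<lambda>_ _. ()),
      smult = (\<lambda>_ _. ()), pts = UNIV, leq = (\<lambda>_ _. True)\<rparr>"

text \<open>Vectors in $B^n$ are functions on the natural numbers that vanish outside $\{1,\dots,n\}$.\<close>

definition free_module :: "'a::ord_comm_semiring set \<Rightarrow> nat \<Rightarrow> ('a, nat \<Rightarrow> 'a) blue_struct" where
  "free_module Bp n =
     \<lparr>carrier = {v. \<forall>i. i \<notin> {1..n} \<longrightarrow> v i = 0}, mult = undefined, one = undefined,
      zero = (\<lambda>_. 0), add = (\<lambda>v w i. v i + w i), smult = (\<lambda>b v i. b * v i),
      pts = {v. (\<forall>i. i \<notin> {1..n} \<longrightarrow> v i = 0) \<and> (\<forall>i\<in>{1..n}. v i \<in> Bp)},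
      leq = (\<lambda>v w. \<forall>i\<in>{1..n}. v i \<le> w i)\<rparr>"

definition basis_vec :: "nat \<Rightarrow> nat \<Rightarrow> 'a::ord_comm_semiring" where
  "basis_vec i = (\<lambda>j. if j = i then 1 else 0)"


section \<open>Quotients by preorders\<close>

definition preorder_equiv :: "('a, 'm) blue_struct \<Rightarrow> ('m \<Rightarrow> 'm \<Rightarrow> bool) \<Rightarrow> ('m \<times> 'm) set" where
  "preorder_equiv M r = {(x, y). x \<in> carrier M \<and> y \<in> carrier M \<and> r x y \<and> r y x}"

definition preorder_quot ::
  "('a, 'm) blue_struct \<Rightarrow> ('m \<Rightarrow> 'm \<Rightarrow> bool) \<Rightarrow> ('a, 'm set) blue_struct" where
  "preorder_quot M r = (let E = preorder_equiv M r in
     \<lparr>carrier = carrier M // E,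
      mult = (\<lambda>X Y. \<Union>x\<in>X. \<Union>y\<in>Y. E `` {x \<otimes>\<^bsub>M\<^esub> y}),
      one = E `` {\<one>\<^bsub>M\<^esub>},
      zero = E `` {\<zero>\<^bsub>M\<^esub>},
      add = (\<lambda>X Y. \<Union>x\<in>X. \<Union>y\<in>Y. E `` {x \<oplus>\<^bsub>M\<^esub> y}),
      smult = (\<lambda>b X. \<Union>x\<in>X. E `` {b \<odot>\<^bsub>M\<^esub> x}),
      pts = (\<lambda>x. E `` {x}) ` pts M,
      leq = (\<lambda>X Y. \<exists>x\<in>X. \<exists>y\<in>Y. r x y)\<rparr>)"


section \<open>Tensor products\<close>

text \<open>
  The free commutative monoid on the pairs $(x, y)$, written as finite multisets;
  \<open>tensor_eq\<close> is the smallest congruence that makes $(x, y) \mapsto x \otimes y$ bilinear, so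
  \<open>formal_sums\<close> modulo \<open>tensor_eq\<close> is $M_1^+ \otimes_{B^+} M_2^+$.
\<close>

definition formal_sums ::
  "('a, 'm) blue_struct \<Rightarrow> ('a, 'k) blue_struct \<Rightarrow> ('a, ('m \<times> 'k) multiset) blue_struct" where
  "formal_sums M N =
     \<lparr>carrier = {s. set_mset s \<subseteq> carrier M \<times> carrier N}, mult = undefined, one = undefined,
      zero = {#}, add = (+), smult = (\<lambda>b s. image_mset (\<lambda>(x, y). (b \<odot>\<^bsub>M\<^esub> x, y)) s),
      pts = {{#(x, y)#} |x y. x \<in> pts M \<and> y \<in> pts N}, leq = (=)\<rparr>"

inductive tensor_eq ::
  "('a, 'm) blue_struct \<Rightarrow> ('a, 'k) blue_struct \<Rightarrow> ('m \<times> 'k) multiset \<Rightarrow> ('m \<times> 'k) multiset \<Rightarrow> bool"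
  for M :: "('a, 'm) blue_struct" and N :: "('a, 'k) blue_struct" where
  refl: "s \<in> carrier (formal_sums M N) \<Longrightarrow> tensor_eq M N s s"
| sym: "tensor_eq M N s t \<Longrightarrow> tensor_eq M N t s"
| trans: "tensor_eq M N s t \<Longrightarrow> tensor_eq M N t u \<Longrightarrow> tensor_eq M N s u"
| add: "tensor_eq M N s t \<Longrightarrow> u \<in> carrier (formal_sums M N) \<Longrightarrow> tensor_eq M N (s + u) (t + u)"
| add_left: "x \<in> carrier M \<Longrightarrow> x' \<in> carrier M \<Longrightarrow> y \<in> carrier N
    \<Longrightarrow> tensor_eq M N {#(x \<oplus>\<^bsub>M\<^esub> x', y)#} {#(x, y), (x', y)#}"
| add_right: "x \<in> carrier M \<Longrightarrow> y \<in> carrier N \<Longrightarrow> y' \<in> carrier N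
    \<Longrightarrow> tensor_eq M N {#(x, y \<oplus>\<^bsub>N\<^esub> y')#} {#(x, y), (x, y')#}"
| zero_left: "y \<in> carrier N \<Longrightarrow> tensor_eq M N {#(\<zero>\<^bsub>M\<^esub>, y)#} {#}"
| zero_right: "x \<in> carrier M \<Longrightarrow> tensor_eq M N {#(x, \<zero>\<^bsub>N\<^esub>)#} {#}"
| smult: "x \<in> carrier M \<Longrightarrow> y \<in> carrier N
    \<Longrightarrow> tensor_eq M N {#(b \<odot>\<^bsub>M\<^esub> x, y)#} {#(x, b \<odot>\<^bsub>N\<^esub> y)#}"

text \<open>
  Preorders on $M_1^+ \otimes_{B^+} M_2^+$ are the same as preorders on formal sums that
  contain \<open>tensor_eq\<close>; the following is the smallest one with the required properties. The two
  successive quotients are therefore taken in a single step.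
\<close>

inductive tensor_le ::
  "('a::ord_comm_semiring, 'm) blue_struct \<Rightarrow> ('a, 'k) blue_struct
    \<Rightarrow> ('m \<times> 'k) multiset \<Rightarrow> ('m \<times> 'k) multiset \<Rightarrow> bool"
  for M :: "('a::ord_comm_semiring, 'm) blue_struct" and N :: "('a, 'k) blue_struct" where
  eq: "tensor_eq M N s t \<Longrightarrow> tensor_le M N s t"
| trans: "tensor_le M N s t \<Longrightarrow> tensor_le M N t u \<Longrightarrow> tensor_le M N s u"
| add: "tensor_le M N s t \<Longrightarrow> u \<in> carrier (formal_sums M N) \<Longrightarrow> tensor_le M N (s + u) (t + u)"
| smult: "b \<le> c \<Longrightarrow> tensor_le M N s t
    \<Longrightarrow> tensor_le M N (b \<odot>\<^bsub>formal_sums M N\<^esub> s) (c \<odot>\<^bsub>formal_sums M N\<^esub> t)"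
| tensor: "x \<in> carrier M \<Longrightarrow> x' \<in> carrier M \<Longrightarrow> y \<in> carrier N \<Longrightarrow> y' \<in> carrier N
    \<Longrightarrow> leq M x x' \<Longrightarrow> leq N y y' \<Longrightarrow> tensor_le M N {#(x, y)#} {#(x', y')#}"

definition tensor_prod ::
  "('a::ord_comm_semiring, 'm) blue_struct \<Rightarrow> ('a, 'k) blue_struct
    \<Rightarrow> ('a, ('m \<times> 'k) multiset set) blue_struct" where
  "tensor_prod M N = preorder_quot (formal_sums M N) (tensor_le M N)"


section \<open>The tensor algebra\<close>

text \<open>
  The type of \<^const>\<open>tensor_prod\<close> grows with its arguments. To iterate it, each tensor power is
  copied into one type \<open>'a tens\<close>, along the injection that sends an equivalence class of formal
  sums to one of its members, wrapped in the constructor \<open>Tens\<close>.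
\<close>

datatype 'a tens = Scal 'a | Tens "('a tens \<times> (nat \<Rightarrow> 'a)) multiset"

definition transport :: "('m \<Rightarrow> 'k) \<Rightarrow> ('a, 'm) blue_struct \<Rightarrow> ('a, 'k) blue_struct" where
  "transport f M = (let g = the_inv_into (carrier M) f in
     \<lparr>carrier = f ` carrier M,
      mult = (\<lambda>x y. f (g x \<otimes>\<^bsub>M\<^esub> g y)),
      one = f \<one>\<^bsub>M\<^esub>,
      zero = f \<zero>\<^bsub>M\<^esub>,
      add = (\<lambda>x y. f (g x \<oplus>\<^bsub>M\<^esub> g y)),
      smult = (\<lambda>b x. f (b \<odot>\<^bsub>M\<^esub> g x)),
      pts = f ` pts M,
      leq = (\<lambda>x y. leq M (g x) (g y))\<rparr>)"

definition encode :: "('a tens \<times> (nat \<Rightarrow> 'a)) multiset set \<Rightarrow> 'a tens" where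
  "encode X = Tens (SOME s. s \<in> X)"

text \<open>$(B^n)^{\otimes 0} = B$ and $(B^n)^{\otimes (l+1)} = (B^n)^{\otimes l} \otimes_B B^n$.\<close>

primrec tensor_power ::
  "'a::ord_comm_semiring set \<Rightarrow> nat \<Rightarrow> nat \<Rightarrow> ('a, 'a tens) blue_struct" where
  "tensor_power Bp n 0 = transport Scal (base_module Bp)"
| "tensor_power Bp n (Suc l) =
     transport encode (tensor_prod (tensor_power Bp n l) (free_module Bp n))"

text \<open>The element of $(B^n)^{\otimes (l+1)}$ represented by the formal sum \<open>s\<close>.\<close>

definition tensor_class ::
  "'a::ord_comm_semiring set \<Rightarrow> nat \<Rightarrow> nat \<Rightarrow> ('a tens \<times> (nat \<Rightarrow> 'a)) multiset \<Rightarrow> 'a tens" where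
  "tensor_class Bp n l s =
     (let M = tensor_power Bp n l; N = free_module Bp n
      in encode (preorder_equiv (formal_sums M N) (tensor_le M N) `` {s}))"

text \<open>
  Concatenation $(B^n)^{\otimes k} \times (B^n)^{\otimes l} \to (B^n)^{\otimes (k+l)}$:
  $x \cdot b = b x$ for $b \in B^+$, and
  $x \cdot \sum_j z_j \otimes v_j = \sum_j (x \cdot z_j) \otimes v_j$.
\<close>

fun tensor_concat ::
  "'a::ord_comm_semiring set \<Rightarrow> nat \<Rightarrow> nat \<Rightarrow> nat \<Rightarrow> 'a tens \<Rightarrow> 'a tens \<Rightarrow> 'a tens" where
  "tensor_concat Bp n k 0 x (Scal b) = b \<odot>\<^bsub>tensor_power Bp n k\<^esub> x"
| "tensor_concat Bp n k (Suc l) x (Tens s) =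
     tensor_class Bp n (k + l) (image_mset (\<lambda>(z, v). (tensor_concat Bp n k l x z, v)) s)"

definition tensor_incl ::
  "'a::ord_comm_semiring set \<Rightarrow> nat \<Rightarrow> nat \<Rightarrow> 'a tens \<Rightarrow> (nat \<Rightarrow> 'a tens)" where
  "tensor_incl Bp n l x = (\<lambda>m. if m = l then x else \<zero>\<^bsub>tensor_power Bp n m\<^esub>)"

definition tensor_algebra ::
  "'a::ord_comm_semiring set \<Rightarrow> nat \<Rightarrow> ('a, nat \<Rightarrow> 'a tens) blue_struct" where
  "tensor_algebra Bp n = (let P = tensor_power Bp n in
     \<lparr>carrier = {f. (\<forall>l. f l \<in> carrier (P l)) \<and> finite {l. f l \<noteq> \<zero>\<^bsub>P l\<^esub>}},
      mult = (\<lambda>f g m. finsum (P m) (\<lambda>k. tensor_concat Bp n k (m - k) (f k) (g (m - k))) {..m}),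
      one = tensor_incl Bp n 0 (Scal 1),
      zero = (\<lambda>l. \<zero>\<^bsub>P l\<^esub>),
      add = (\<lambda>f g l. f l \<oplus>\<^bsub>P l\<^esub> g l),
      smult = (\<lambda>b f l. b \<odot>\<^bsub>P l\<^esub> f l),
      pts = (\<Union>l. tensor_incl Bp n l ` pts (P l)),
      leq = (\<lambda>f g. \<forall>l. leq (P l) (f l) (g l))\<rparr>)"

text \<open>The vector $e_i$ as the element $1 \otimes e_i$ of degree one.\<close>

definition tensor_gen :: "'a::ord_comm_semiring set \<Rightarrow> nat \<Rightarrow> nat \<Rightarrow> (nat \<Rightarrow> 'a tens)" where
  "tensor_gen Bp n i = tensor_incl Bp n 1 (tensor_class Bp n 0 {#(Scal 1, basis_vec i)#})"


section \<open>The exterior algebra\<close>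

inductive algebra_preorder ::
  "('a, 'm) blue_struct \<Rightarrow> ('m \<times> 'm) set \<Rightarrow> 'm \<Rightarrow> 'm \<Rightarrow> bool"
  for A :: "('a, 'm) blue_struct" and R :: "('m \<times> 'm) set" where
  base: "x \<in> carrier A \<Longrightarrow> y \<in> carrier A \<Longrightarrow> leq A x y \<Longrightarrow> algebra_preorder A R x y"
| rel: "(x, y) \<in> R \<Longrightarrow> algebra_preorder A R x y"
| rel_sym: "(x, y) \<in> R \<Longrightarrow> algebra_preorder A R y x"
| trans: "algebra_preorder A R x y \<Longrightarrow> algebra_preorder A R y z \<Longrightarrow> algebra_preorder A R x z"
| add: "algebra_preorder A R x y \<Longrightarrow> z \<in> carrier A
    \<Longrightarrow> algebra_preorder A R (x \<oplus>\<^bsub>A\<^esub> z) (y \<oplus>\<^bsub>A\<^esub> z)"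
| mult_left: "algebra_preorder A R x y \<Longrightarrow> z \<in> carrier A
    \<Longrightarrow> algebra_preorder A R (z \<otimes>\<^bsub>A\<^esub> x) (z \<otimes>\<^bsub>A\<^esub> y)"
| mult_right: "algebra_preorder A R x y \<Longrightarrow> z \<in> carrier A
    \<Longrightarrow> algebra_preorder A R (x \<otimes>\<^bsub>A\<^esub> z) (y \<otimes>\<^bsub>A\<^esub> z)"

definition exterior_rel ::
  "'a::ord_comm_semiring set \<Rightarrow> 'a \<Rightarrow> nat \<Rightarrow> ((nat \<Rightarrow> 'a tens) \<times> (nat \<Rightarrow> 'a tens)) set" where
  "exterior_rel Bp eps n = (let T = tensor_algebra Bp n; e = tensor_gen Bp n in
     {(e i \<otimes>\<^bsub>T\<^esub> e i, \<zero>\<^bsub>T\<^esub>) |i. i \<in> {1..n}} \<union>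
     {(e i \<otimes>\<^bsub>T\<^esub> e j, eps \<odot>\<^bsub>T\<^esub> (e j \<otimes>\<^bsub>T\<^esub> e i)) |i j. i \<in> {1..n} \<and> j \<in> {1..n} \<and> i \<noteq> j})"

definition exterior_le ::
  "'a::ord_comm_semiring set \<Rightarrow> 'a \<Rightarrow> nat \<Rightarrow> (nat \<Rightarrow> 'a tens) \<Rightarrow> (nat \<Rightarrow> 'a tens) \<Rightarrow> bool" where
  "exterior_le Bp eps n = algebra_preorder (tensor_algebra Bp n) (exterior_rel Bp eps n)"

text \<open>
  The ambient algebra $A_n$. Its field \<open>pts\<close>, here the image of the underlying set of
  $T(B^n)$, is not the underlying set of $\bigwedge B^n$ and is replaced below.
\<close>

definition exterior_ambient ::
  "'a::ord_comm_semiring set \<Rightarrow> 'a \<Rightarrow> nat \<Rightarrow> ('a, (nat \<Rightarrow> 'a tens) set) blue_struct" where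
  "exterior_ambient Bp eps n = preorder_quot (tensor_algebra Bp n) (exterior_le Bp eps n)"

definition exterior_basis ::
  "'a::ord_comm_semiring set \<Rightarrow> 'a \<Rightarrow> nat \<Rightarrow> nat set \<Rightarrow> (nat \<Rightarrow> 'a tens) set" where
  "exterior_basis Bp eps n I = (let T = tensor_algebra Bp n in
     preorder_equiv T (exterior_le Bp eps n) ``
       {foldr (\<otimes>\<^bsub>T\<^esub>) (map (tensor_gen Bp n) (sorted_list_of_set I)) \<one>\<^bsub>T\<^esub>})"

definition exterior_pts ::
  "'a::ord_comm_semiring set \<Rightarrow> 'a \<Rightarrow> nat \<Rightarrow> nat \<Rightarrow> (nat \<Rightarrow> 'a tens) set set" where
  "exterior_pts Bp eps d n = (let A = exterior_ambient Bp eps n in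
     {finsum A (\<lambda>I. b I \<odot>\<^bsub>A\<^esub> exterior_basis Bp eps n I) {I. I \<subseteq> {1..n} \<and> card I = d} |b.
        \<forall>I. b I \<in> Bp})"

inductive_set submodule_span :: "('a, 'm) blue_struct \<Rightarrow> 'm set \<Rightarrow> 'm set"
  for M :: "('a, 'm) blue_struct" and G :: "'m set" where
  incl: "x \<in> G \<Longrightarrow> x \<in> submodule_span M G"
| zero: "\<zero>\<^bsub>M\<^esub> \<in> submodule_span M G"
| add: "x \<in> submodule_span M G \<Longrightarrow> y \<in> submodule_span M G \<Longrightarrow> x \<oplus>\<^bsub>M\<^esub> y \<in> submodule_span M G"
| smult: "x \<in> submodule_span M G \<Longrightarrow> b \<odot>\<^bsub>M\<^esub> x \<in> submodule_span M G"

definition exterior_power ::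
  "'a::ord_comm_semiring set \<Rightarrow> 'a \<Rightarrow> nat \<Rightarrow> nat \<Rightarrow> ('a, (nat \<Rightarrow> 'a tens) set) blue_struct" where
  "exterior_power Bp eps d n = (exterior_ambient Bp eps n)
     \<lparr>carrier := submodule_span (exterior_ambient Bp eps n) (exterior_pts Bp eps d n),
      pts := exterior_pts Bp eps d n\<rparr>"

definition exterior_algebra ::
  "'a::ord_comm_semiring set \<Rightarrow> 'a \<Rightarrow> nat \<Rightarrow> ('a, (nat \<Rightarrow> 'a tens) set) blue_struct" where
  "exterior_algebra Bp eps n = (exterior_ambient Bp eps n)
     \<lparr>pts := (\<Union>l\<in>{0..n}. exterior_pts Bp eps l n)\<rparr>"

inductive_set subalgebra_span :: "('a, 'm) blue_struct \<Rightarrow> 'm set \<Rightarrow> 'm set"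
  for A :: "('a, 'm) blue_struct" and G :: "'m set" where
  incl: "x \<in> G \<Longrightarrow> x \<in> subalgebra_span A G"
| zero: "\<zero>\<^bsub>A\<^esub> \<in> subalgebra_span A G"
| one: "\<one>\<^bsub>A\<^esub> \<in> subalgebra_span A G"
| add: "x \<in> subalgebra_span A G \<Longrightarrow> y \<in> subalgebra_span A G \<Longrightarrow> x \<oplus>\<^bsub>A\<^esub> y \<in> subalgebra_span A G"
| mult: "x \<in> subalgebra_span A G \<Longrightarrow> y \<in> subalgebra_span A G \<Longrightarrow> x \<otimes>\<^bsub>A\<^esub> y \<in> subalgebra_span A G"
| smult: "x \<in> subalgebra_span A G \<Longrightarrow> b \<odot>\<^bsub>A\<^esub> x \<in> subalgebra_span A G"

end

theory Submission
  imports Defs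
begin

text \<open>
  The ambient algebra $A_n$ is the quotient of $T(B^n)$ by relations that are homogeneous of degree
  two, and multiplication never lowers degrees. Hence the preorder that defines $A_n$ compares
  components of degree zero and one exactly as the order of $T(B^n)$ does
  (\<open>exterior_le_low_degree\<close>), so that $(B^n)^{\otimes 0} = B$ and
  $(B^n)^{\otimes 1} = B \otimes B^n \cong B^n$ embed into $A_n$ as ordered modules. For the second
  of them one needs that $v \mapsto 1 \otimes v$ is bijective and reflects the order; the evaluation
  $\sum_j b_j \otimes v_j \mapsto \sum_j b_j v_j$ shows the latter. The images of $B^\bullet$ and
  $(B^n)^\bullet$ under these embeddings are the underlying sets of $\bigwedge^0 B^n$ and
  $\bigwedge^1 B^n$, and a linear order embedding of a module that matches the underlying sets is an
  isomorphism onto the submodule spanned by the image (\<open>blue_isomorphic_span\<close>). For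
  $k > n$ there is no $k$-element subset of $[n]$, so that $H_{k,n} = \{0\}$.

  The algebra $A_n$ is generated in degree one because $T(B^n)$ is: an element of
  $(B^n)^{\otimes (l+1)}$ is a sum of products $z \cdot (1 \otimes v)$ with
  $z \in (B^n)^{\otimes l}$ (\<open>tensor_algebra_generated\<close>).

  Most of the work is to show that these objects are what they should be: that tensor powers are
  ordered semimodules, that concatenation is well defined, bilinear and monotone
  (\<open>monotone_linear_concat_right\<close>, \<open>monotone_linear_concat_left\<close>), and that
  the operations descend to $A_n$.
\<close>

section \<open>Ordered semimodules and monotone linear maps\<close>

text \<open>
  A \<^locale>\<open>blue_module\<close> without its underlying set. All constructions on the way to the exterior
  algebra are carried out on this level; an underlying set is chosen only at the end, see
  \<open>blue_module_span\<close>.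
\<close>

locale ordered_semimodule = abelian_monoid M
  for M :: "('a::ord_comm_semiring, 'm) blue_struct" (structure) +
  assumes smult_closed: "x \<in> carrier M \<Longrightarrow> b \<odot> x \<in> carrier M"
    and smult_add_left: "x \<in> carrier M \<Longrightarrow> (b + c) \<odot> x = b \<odot> x \<oplus> c \<odot> x"
    and smult_add_right:
      "x \<in> carrier M \<Longrightarrow> y \<in> carrier M \<Longrightarrow> b \<odot> (x \<oplus> y) = b \<odot> x \<oplus> b \<odot> y"
    and smult_smult: "x \<in> carrier M \<Longrightarrow> (b * c) \<odot> x = b \<odot> (c \<odot> x)"
    and one_smult: "x \<in> carrier M \<Longrightarrow> 1 \<odot> x = x"
    and zero_smult: "x \<in> carrier M \<Longrightarrow> 0 \<odot> x = \<zero>"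
    and smult_zero: "b \<odot> \<zero> = \<zero>"
    and leq_refl: "x \<in> carrier M \<Longrightarrow> leq M x x"
    and leq_antisym: "x \<in> carrier M \<Longrightarrow> y \<in> carrier M \<Longrightarrow> leq M x y \<Longrightarrow> leq M y x \<Longrightarrow> x = y"
    and leq_trans:
      "x \<in> carrier M \<Longrightarrow> y \<in> carrier M \<Longrightarrow> z \<in> carrier M \<Longrightarrow> leq M x y \<Longrightarrow> leq M y z \<Longrightarrow> leq M x z"
    and leq_add:
      "x \<in> carrier M \<Longrightarrow> y \<in> carrier M \<Longrightarrow> z \<in> carrier M \<Longrightarrow> leq M x y
        \<Longrightarrow> leq M (x \<oplus> z) (y \<oplus> z)"
    and leq_smult:
      "x \<in> carrier M \<Longrightarrow> y \<in> carrier M \<Longrightarrow> b \<le> c \<Longrightarrow> leq M x y \<Longrightarrow> leq M (b \<odot> x) (c \<odot> y)"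
begin

lemma leq_add_both:
  assumes "x \<in> carrier M" "x' \<in> carrier M" "y \<in> carrier M" "y' \<in> carrier M"
    and "leq M x x'" "leq M y y'"
  shows "leq M (x \<oplus> y) (x' \<oplus> y')"
proof -
  have "leq M (x \<oplus> y) (x' \<oplus> y)" "leq M (y \<oplus> x') (y' \<oplus> x')"
    using assms by (auto intro: leq_add)
  then show ?thesis
    using assms leq_trans[of "x \<oplus> y" "x' \<oplus> y" "x' \<oplus> y'"] by (simp add: a_comm)
qed

lemma leq_finsum:
  assumes "finite S" "f \<in> S \<rightarrow> carrier M" "g \<in> S \<rightarrow> carrier M" "\<And>i. i \<in> S \<Longrightarrow> leq M (f i) (g i)"
  shows "leq M (finsum M f S) (finsum M g S)"
  using assms by (induction S) (auto simp: leq_refl Pi_def intro!: leq_add_both)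

end

locale monotone_linear =
  fixes M :: "('a::ord_comm_semiring, 'm) blue_struct" and N :: "('a, 'k) blue_struct"
    and f :: "'m \<Rightarrow> 'k"
  assumes map_closed: "x \<in> carrier M \<Longrightarrow> f x \<in> carrier N"
    and map_zero: "f \<zero>\<^bsub>M\<^esub> = \<zero>\<^bsub>N\<^esub>"
    and map_add: "x \<in> carrier M \<Longrightarrow> y \<in> carrier M \<Longrightarrow> f (x \<oplus>\<^bsub>M\<^esub> y) = f x \<oplus>\<^bsub>N\<^esub> f y"
    and map_smult: "x \<in> carrier M \<Longrightarrow> f (b \<odot>\<^bsub>M\<^esub> x) = b \<odot>\<^bsub>N\<^esub> f x"
    and map_mono: "x \<in> carrier M \<Longrightarrow> y \<in> carrier M \<Longrightarrow> leq M x y \<Longrightarrow> leq N (f x) (f y)"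

lemma monotone_linear_comp:
  "monotone_linear M N f \<Longrightarrow> monotone_linear N L g \<Longrightarrow> monotone_linear M L (\<lambda>x. g (f x))"
  by (simp add: monotone_linear_def)

lemma (in monotone_linear) span_image:
  assumes "ordered_semimodule M" "G \<subseteq> carrier M"
  shows "f ` submodule_span M G = submodule_span N (f ` G)"
proof -
  interpret M: ordered_semimodule M by fact
  have carrier: "x \<in> carrier M" if "x \<in> submodule_span M G" for x
    using that by induction (use assms(2) M.smult_closed in auto)
  show ?thesis
  proof (intro equalityI subsetI)
    fix y assume "y \<in> f ` submodule_span M G"
    then obtain x where "x \<in> submodule_span M G" "y = f x" by blast
    moreover from this(1) have "f x \<in> submodule_span N (f ` G)"
      by induction (auto simp: map_zero map_add map_smult carrier intro: submodule_span.intros)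
    ultimately show "y \<in> submodule_span N (f ` G)" by simp
  next
    fix y assume "y \<in> submodule_span N (f ` G)"
    then show "y \<in> f ` submodule_span M G"
    proof induction
      case zero
      then show ?case
        by (metis map_zero image_eqI submodule_span.zero)
    next
      case (add x y)
      then show ?case
        by (auto simp flip: map_add simp: carrier intro!: imageI submodule_span.add)
    next
      case (smult x b)
      then show ?case
        by (auto simp flip: map_smult simp: carrier intro!: imageI submodule_span.smult)
    qed (auto intro: submodule_span.incl)
  qed
qed


section \<open>Blue modules spanned by their underlying sets\<close>

lemma (in ordered_semimodule) span_closed:
  assumes "H \<subseteq> carrier M" "x \<in> submodule_span M H"
  shows "x \<in> carrier M"
  using assms(2) by induction (use assms(1) smult_closed in auto)

text \<open>
  Multiples by arbitrary elements of $B^+$ are sums of multiples by elements of $B^\bullet$, so the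
  span of a set that is stable under $B^\bullet$ consists of finite sums of its elements.
\<close>

lemma (in ordered_semimodule) span_finite_sums:
  assumes "ordered_blueprint Bp" "H \<subseteq> carrier M"
    and stable: "\<And>b x. b \<in> Bp \<Longrightarrow> x \<in> H \<Longrightarrow> b \<odot> x \<in> H"
    and "x \<in> submodule_span M H"
  shows "\<exists>xs. set xs \<subseteq> H \<and> x = foldr (\<oplus>) xs \<zero>"
proof -
  interpret B: ordered_blueprint Bp by fact
  have sum_closed: "foldr (\<oplus>) xs \<zero> \<in> carrier M" if "set xs \<subseteq> H" for xs
    using that assms(2) by (induction xs) auto
  have sum_append: "foldr (\<oplus>) (xs @ ys) \<zero> = foldr (\<oplus>) xs \<zero> \<oplus> foldr (\<oplus>) ys \<zero>"
    if "set xs \<subseteq> H" "set ys \<subseteq> H" for xs ys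
    using that
  proof (induction xs)
    case (Cons x xs)
    then have "x \<in> carrier M" "set xs \<subseteq> H" using assms(2) by auto
    then show ?case using Cons sum_closed[of xs] sum_closed[of ys] by (simp add: a_assoc)
  qed (simp add: sum_closed)
  have smult_sum: "foldr (\<oplus>) (map ((\<odot>) b) xs) \<zero> = b \<odot> foldr (\<oplus>) xs \<zero>" if "set xs \<subseteq> H" for b xs
    using that
  proof (induction xs)
    case (Cons x xs)
    then have "x \<in> carrier M" "set xs \<subseteq> H" using assms(2) by auto
    then show ?case using Cons sum_closed[of xs] by (simp add: smult_add_right)
  qed (simp add: smult_zero)
  from assms(4) show ?thesis
  proof induction
    case (incl x)
    then show ?case using assms(2) by (intro exI[of _ "[x]"]) auto
  next
    case zero
    then show ?case by (intro exI[of _ "[]"]) simp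
  next
    case (add x y)
    then obtain xs ys where "set xs \<subseteq> H" "x = foldr (\<oplus>) xs \<zero>" "set ys \<subseteq> H" "y = foldr (\<oplus>) ys \<zero>"
      by blast
    then show ?case by (intro exI[of _ "xs @ ys"]) (simp add: sum_append del: foldr_append)
  next
    case (smult x b)
    then obtain xs where xs: "set xs \<subseteq> H" "x = foldr (\<oplus>) xs \<zero>" by blast
    obtain as where as: "set as \<subseteq> Bp" "b = sum_list as" using B.generates by blast
    have "\<exists>zs. set zs \<subseteq> H \<and> sum_list as \<odot> x = foldr (\<oplus>) zs \<zero>"
      using as(1)
    proof (induction as)
      case Nil
      then show ?case
        using xs sum_closed by (intro exI[of _ "[]"]) (simp add: zero_smult)
    next
      case (Cons a as)
      then obtain zs where zs: "set zs \<subseteq> H" "sum_list as \<odot> x = foldr (\<oplus>) zs \<zero>" by auto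
      have ax: "set (map ((\<odot>) a) xs) \<subseteq> H" using Cons xs stable by auto
      show ?case
        using zs ax xs sum_closed
        by (intro exI[of _ "map ((\<odot>) a) xs @ zs"])
           (auto simp: sum_append smult_sum smult_add_left simp del: foldr_append)
    qed
    then show ?case using as by simp
  qed
qed

lemma (in ordered_semimodule) blue_module_span:
  assumes "ordered_blueprint Bp" "H \<subseteq> carrier M" "\<zero> \<in> H"
    and stable: "\<And>b x. b \<in> Bp \<Longrightarrow> x \<in> H \<Longrightarrow> b \<odot> x \<in> H"
  shows "blue_module Bp (M\<lparr>carrier := submodule_span M H, pts := H\<rparr>)"
    (is "blue_module Bp ?S")
proof -
  note closed = span_closed[OF assms(2)]
  have "abelian_monoid ?S"
    by (intro abelian_monoidI)
       (auto simp: a_assoc closed submodule_span.zero submodule_span.add intro: a_comm closed)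
  moreover have "blue_module_axioms Bp ?S"
  proof
    show "reflp_on (carrier ?S) (leq ?S)"
      by (auto intro!: reflp_onI leq_refl closed)
    show "antisymp_on (carrier ?S) (leq ?S)"
      by (auto intro!: antisymp_onI leq_antisym closed)
    show "transp_on (carrier ?S) (leq ?S)"
      by (auto intro!: transp_onI intro: leq_trans closed)
    show "\<exists>xs. set xs \<subseteq> pts ?S \<and> x = foldr (\<oplus>\<^bsub>?S\<^esub>) xs \<zero>\<^bsub>?S\<^esub>" if "x \<in> carrier ?S" for x
      using span_finite_sums[OF assms(1,2) stable] that by simp
  qed (auto simp: closed smult_add_left smult_add_right smult_smult one_smult zero_smult smult_zero
        assms stable leq_add leq_smult intro: submodule_span.intros)
  ultimately show ?thesis
    using assms(1) by (intro blue_module.intro)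
qed

lemma blue_module_ordered_semimodule:
  assumes "blue_module Bp M"
  shows "ordered_semimodule M"
proof -
  interpret M: blue_module Bp M by fact
  show ?thesis
    using M.leq_refl M.leq_antisym M.leq_trans
    by unfold_locales
       (auto simp: M.smult_closed M.smult_add_left M.smult_add_right M.smult_smult M.one_smult
         M.zero_smult M.smult_zero M.leq_add M.leq_smult
         dest: reflp_onD antisymp_onD transp_onD)
qed

lemma blue_module_spanned:
  assumes "blue_module Bp M"
  shows "submodule_span M (pts M) = carrier M"
proof -
  interpret M: blue_module Bp M by fact
  have "x \<in> submodule_span M (pts M)" if x: "x \<in> carrier M" for x
  proof -
    obtain xs where "set xs \<subseteq> pts M" "x = foldr (\<oplus>\<^bsub>M\<^esub>) xs \<zero>\<^bsub>M\<^esub>"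
      using M.pts_generate[OF x] by blast
    then show ?thesis
      by (induction xs arbitrary: x) (auto intro: submodule_span.intros)
  qed
  then show ?thesis
    using ordered_semimodule.span_closed[OF blue_module_ordered_semimodule[OF assms] M.pts_subset]
    by blast
qed

text \<open>
  A linear map that reflects the order is injective, and its image is spanned by the image of
  $M^\bullet$, because $M^\bullet$ spans $M^+$. Applied with $N = A_n$, this identifies exterior
  powers.
\<close>

lemma blue_isomorphic_span:
  fixes f :: "'m \<Rightarrow> 'k" and M :: "('a::ord_comm_semiring, 'm) blue_struct"
  assumes "blue_module Bp M" "ordered_semimodule N" "monotone_linear M N f"
    and reflect: "\<And>x y. x \<in> carrier M \<Longrightarrow> y \<in> carrier M \<Longrightarrow> leq N (f x) (f y) \<Longrightarrow> leq M x y"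
    and H: "f ` pts M = H"
  shows "blue_isomorphic Bp M (N\<lparr>carrier := submodule_span N H, pts := H\<rparr>)"
    (is "blue_isomorphic Bp M ?S")
proof -
  interpret M: blue_module Bp M by fact
  interpret N: ordered_semimodule N by fact
  interpret f: monotone_linear M N f by fact
  have ordered_M: "ordered_semimodule M"
    using assms(1) by (rule blue_module_ordered_semimodule)
  have image: "f ` carrier M = submodule_span N H"
    using f.span_image[OF ordered_M M.pts_subset] H blue_module_spanned[OF assms(1)] by simp
  have inj: "inj_on f (carrier M)"
    by (rule inj_onI)
       (metis N.leq_refl antisymp_onD f.map_closed M.leq_antisym reflect)
  define g where "g = the_inv_into (carrier M) f"
  have gf: "g (f x) = x" if "x \<in> carrier M" for x
    unfolding g_def using inj that by (rule the_inv_into_f_f)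
  have "blue_module Bp ?S"
  proof (rule N.blue_module_span)
    show "H \<subseteq> carrier N" using H M.pts_subset f.map_closed by blast
    show "\<zero>\<^bsub>N\<^esub> \<in> H" using H M.zero_pts f.map_zero by (metis imageI)
    show "b \<odot>\<^bsub>N\<^esub> x \<in> H" if b: "b \<in> Bp" and x: "x \<in> H" for b x
    proof -
      obtain y where "y \<in> pts M" "x = f y" using x H by blast
      then show ?thesis
        using M.smult_pts[OF b] M.pts_subset H by (auto simp flip: f.map_smult)
    qed
  qed (rule M.ordered_blueprint_axioms)
  moreover have "f \<in> blue_hom M ?S"
    using H image by (auto simp: blue_hom_def f.map_zero f.map_add f.map_smult f.map_mono)
  moreover have "g \<in> blue_hom ?S M"
    unfolding blue_hom_def
  proof (intro CollectI conjI ballI allI impI)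
    show "g \<zero>\<^bsub>?S\<^esub> = \<zero>\<^bsub>M\<^esub>" using gf[of "\<zero>\<^bsub>M\<^esub>"] f.map_zero by simp
    show "g ` pts ?S \<subseteq> pts M" using gf H M.pts_subset by auto
    fix x y assume "x \<in> carrier ?S" "y \<in> carrier ?S"
    then have "x \<in> f ` carrier M" "y \<in> f ` carrier M" using image by simp_all
    then obtain u v where uv: "u \<in> carrier M" "x = f u" "v \<in> carrier M" "y = f v" by blast
    show "g (x \<oplus>\<^bsub>?S\<^esub> y) = g x \<oplus>\<^bsub>M\<^esub> g y"
      using uv gf[of "u \<oplus>\<^bsub>M\<^esub> v"] by (simp add: gf f.map_add)
    show "leq M (g x) (g y)" if "leq ?S x y" using that uv by (simp add: gf reflect)
  next
    fix b x assume "x \<in> carrier ?S"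
    then have "x \<in> f ` carrier M" using image by simp
    then obtain u where u: "u \<in> carrier M" "x = f u" by blast
    then show "g (b \<odot>\<^bsub>?S\<^esub> x) = b \<odot>\<^bsub>M\<^esub> g x"
      using gf[of "b \<odot>\<^bsub>M\<^esub> u"] by (simp add: gf f.map_smult M.smult_closed)
  qed (use image[symmetric] gf in auto)
  moreover have "f (g y) = y" if "y \<in> carrier ?S" for y
    using that image[symmetric] gf by auto
  ultimately show ?thesis
    unfolding blue_isomorphic_def using gf M.blue_module_axioms by blast
qed


section \<open>Quotients by preorders\<close>

text \<open>
  The module laws are required only up to the equivalence of the preorder; this covers formal sums,
  where for instance $(b + c) s$ and $b s + c s$ are different multisets.
\<close>

locale preordered_semimodule = abelian_monoid M
  for M :: "('a::ord_comm_semiring, 'm) blue_struct" (structure) +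
  fixes r :: "'m \<Rightarrow> 'm \<Rightarrow> bool"
  assumes r_carrier: "r x y \<Longrightarrow> x \<in> carrier M \<and> y \<in> carrier M"
    and r_refl: "x \<in> carrier M \<Longrightarrow> r x x"
    and r_trans: "r x y \<Longrightarrow> r y z \<Longrightarrow> r x z"
    and r_add: "r x y \<Longrightarrow> z \<in> carrier M \<Longrightarrow> r (x \<oplus> z) (y \<oplus> z)"
    and r_smult: "b \<le> c \<Longrightarrow> r x y \<Longrightarrow> r (b \<odot> x) (c \<odot> y)"
    and smult_closed: "x \<in> carrier M \<Longrightarrow> b \<odot> x \<in> carrier M"
    and smult_add_left:
      "x \<in> carrier M \<Longrightarrow> ((b + c) \<odot> x, b \<odot> x \<oplus> c \<odot> x) \<in> preorder_equiv M r"
    and smult_add_right: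
      "x \<in> carrier M \<Longrightarrow> y \<in> carrier M
        \<Longrightarrow> (b \<odot> (x \<oplus> y), b \<odot> x \<oplus> b \<odot> y) \<in> preorder_equiv M r"
    and smult_smult: "x \<in> carrier M \<Longrightarrow> ((b * c) \<odot> x, b \<odot> (c \<odot> x)) \<in> preorder_equiv M r"
    and one_smult: "x \<in> carrier M \<Longrightarrow> (1 \<odot> x, x) \<in> preorder_equiv M r"
    and zero_smult: "x \<in> carrier M \<Longrightarrow> (0 \<odot> x, \<zero>) \<in> preorder_equiv M r"
    and smult_zero: "(b \<odot> \<zero>, \<zero>) \<in> preorder_equiv M r"
begin

abbreviation cls :: "'m \<Rightarrow> 'm set" where
  "cls x \<equiv> preorder_equiv M r `` {x}"

lemma equiv_preorder: "equiv (carrier M) (preorder_equiv M r)"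
  unfolding preorder_equiv_def
  by (intro equivI refl_onI symI transI) (auto simp: r_refl elim: r_trans)

lemma cls_eqI: "(x, y) \<in> preorder_equiv M r \<Longrightarrow> cls x = cls y"
  by (rule equiv_class_eq[OF equiv_preorder])

lemma r_add_both: "r x x' \<Longrightarrow> r y y' \<Longrightarrow> r (x \<oplus> y) (x' \<oplus> y')"
  by (rule r_trans[of _ "x' \<oplus> y"]) (use r_add[of y y' x'] r_carrier in \<open>auto simp: r_add a_comm\<close>)

lemma carrier_quot: "carrier (preorder_quot M r) = cls ` carrier M"
  by (auto simp: preorder_quot_def Let_def quotient_def)

lemma zero_quot: "\<zero>\<^bsub>preorder_quot M r\<^esub> = cls \<zero>"
  by (simp add: preorder_quot_def Let_def)

lemma add_quot:
  assumes "x \<in> carrier M" "y \<in> carrier M"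
  shows "cls x \<oplus>\<^bsub>preorder_quot M r\<^esub> cls y = cls (x \<oplus> y)"
proof -
  have "congruent2 (preorder_equiv M r) (preorder_equiv M r) (\<lambda>x y. cls (x \<oplus> y))"
    by (intro congruent2I' cls_eqI) (auto simp: preorder_equiv_def intro: r_add_both)
  from UN_equiv_class2[OF equiv_preorder equiv_preorder this assms] show ?thesis
    by (simp add: preorder_quot_def Let_def)
qed

lemma mult_quot:
  assumes "x \<in> carrier M" "y \<in> carrier M"
    and closed: "\<And>x y. x \<in> carrier M \<Longrightarrow> y \<in> carrier M \<Longrightarrow> x \<otimes> y \<in> carrier M"
    and left: "\<And>x y z. r x y \<Longrightarrow> z \<in> carrier M \<Longrightarrow> r (z \<otimes> x) (z \<otimes> y)"
    and right: "\<And>x y z. r x y \<Longrightarrow> z \<in> carrier M \<Longrightarrow> r (x \<otimes> z) (y \<otimes> z)"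
  shows "cls x \<otimes>\<^bsub>preorder_quot M r\<^esub> cls y = cls (x \<otimes> y)"
proof -
  have "r (x \<otimes> y) (x' \<otimes> y')" if "r x x'" "r y y'" for x x' y y'
    by (rule r_trans[OF right[OF that(1)] left[OF that(2)]]) (use that r_carrier in auto)
  then have "congruent2 (preorder_equiv M r) (preorder_equiv M r) (\<lambda>x y. cls (x \<otimes> y))"
    unfolding preorder_equiv_def
    by (intro congruent2I' cls_eqI[unfolded preorder_equiv_def]) (auto simp: closed)
  from UN_equiv_class2[OF equiv_preorder equiv_preorder this assms(1,2)] show ?thesis
    by (simp add: preorder_quot_def Let_def)
qed

lemma smult_quot:
  assumes "x \<in> carrier M"
  shows "b \<odot>\<^bsub>preorder_quot M r\<^esub> cls x = cls (b \<odot> x)"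
proof -
  have "(\<lambda>x. cls (b \<odot> x)) respects preorder_equiv M r"
    by (intro congruentI cls_eqI) (auto simp: preorder_equiv_def smult_closed r_smult)
  from UN_equiv_class[OF equiv_preorder this assms] show ?thesis
    by (simp add: preorder_quot_def Let_def)
qed

lemma leq_quot:
  assumes "x \<in> carrier M" "y \<in> carrier M"
  shows "leq (preorder_quot M r) (cls x) (cls y) \<longleftrightarrow> r x y"
  using assms
  by (auto simp: preorder_quot_def Let_def preorder_equiv_def intro: r_refl dest: r_trans)

lemmas quot_simps = carrier_quot zero_quot add_quot smult_quot leq_quot

lemma ordered_semimodule_quot: "ordered_semimodule (preorder_quot M r)"
proof (intro ordered_semimodule.intro)
  show "abelian_monoid (preorder_quot M r)"
    by (rule abelian_monoidI) (auto simp: quot_simps a_ac)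
  show "ordered_semimodule_axioms (preorder_quot M r)"
    by (unfold_locales; unfold carrier_quot zero_quot; (elim imageE)?)
       (simp_all add: quot_simps smult_closed r_refl r_smult r_add
          cls_eqI smult_add_left smult_add_right smult_smult one_smult zero_smult smult_zero,
        rule cls_eqI, simp add: preorder_equiv_def, erule (1) r_trans)
qed

end

lemma transport_simps:
  assumes "inj_on f (carrier M)"
  shows "carrier (transport f M) = f ` carrier M"
    and "\<zero>\<^bsub>transport f M\<^esub> = f \<zero>\<^bsub>M\<^esub>"
    and "x \<in> carrier M \<Longrightarrow> y \<in> carrier M \<Longrightarrow> f x \<oplus>\<^bsub>transport f M\<^esub> f y = f (x \<oplus>\<^bsub>M\<^esub> y)"
    and "x \<in> carrier M \<Longrightarrow> b \<odot>\<^bsub>transport f M\<^esub> f x = f (b \<odot>\<^bsub>M\<^esub> x)"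
    and "x \<in> carrier M \<Longrightarrow> y \<in> carrier M \<Longrightarrow> leq (transport f M) (f x) (f y) \<longleftrightarrow> leq M x y"
  using assms by (simp_all add: transport_def Let_def the_inv_into_f_f)

lemma ordered_semimodule_transport:
  assumes "inj_on f (carrier M)" "ordered_semimodule M"
  shows "ordered_semimodule (transport f M)"
proof (intro ordered_semimodule.intro)
  interpret M: ordered_semimodule M by fact
  note simps = transport_simps[OF assms(1)]
  show "abelian_monoid (transport f M)"
    by (rule abelian_monoidI) (auto simp: simps M.a_ac)
  show "ordered_semimodule_axioms (transport f M)"
    by (unfold_locales; unfold simps(1,2); (elim imageE)?)
       (simp_all add: simps M.smult_closed M.smult_add_left M.smult_add_right M.smult_smult
          M.one_smult M.zero_smult M.smult_zero M.leq_refl M.leq_add M.leq_smult,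
        metis M.leq_antisym, metis M.leq_trans)
qed


section \<open>Tensor products\<close>

lemma formal_sums_simps [simp]:
  "carrier (formal_sums M N) = {s. set_mset s \<subseteq> carrier M \<times> carrier N}"
  "\<zero>\<^bsub>formal_sums M N\<^esub> = {#}"
  "s \<oplus>\<^bsub>formal_sums M N\<^esub> t = s + t"
  "b \<odot>\<^bsub>formal_sums M N\<^esub> s = image_mset (\<lambda>(x, y). (b \<odot>\<^bsub>M\<^esub> x, y)) s"
  by (simp_all add: formal_sums_def)

locale tensor_factors = M: ordered_semimodule M + N: ordered_semimodule N
  for M :: "('a::ord_comm_semiring, 'm) blue_struct" and N :: "('a, 'k) blue_struct"
begin

lemma tensor_eq_carrier:
  "tensor_eq M N s t \<Longrightarrow> s \<in> carrier (formal_sums M N) \<and> t \<in> carrier (formal_sums M N)"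
  by (induction rule: tensor_eq.induct) (auto simp: M.smult_closed N.smult_closed)

lemma tensor_le_carrier:
  "tensor_le M N s t \<Longrightarrow> s \<in> carrier (formal_sums M N) \<and> t \<in> carrier (formal_sums M N)"
  by (induction rule: tensor_le.induct)
     (auto dest: tensor_eq_carrier simp: M.smult_closed split_beta subset_iff)

lemma tensor_eq_add_both:
  assumes "tensor_eq M N s s'" "tensor_eq M N t t'"
  shows "tensor_eq M N (s + t) (s' + t')"
proof (rule tensor_eq.trans)
  show "tensor_eq M N (s + t) (s' + t)"
    using assms tensor_eq_carrier by (intro tensor_eq.add) blast+
  show "tensor_eq M N (s' + t) (s' + t')"
    using tensor_eq.add[OF assms(2), of s'] assms(1) tensor_eq_carrier by (simp add: add.commute)
qed

lemma formal_sum_split: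
  assumes "add_mset (x, y) s \<in> carrier (formal_sums M N)"
  shows "x \<in> carrier M" "y \<in> carrier N" "s \<in> carrier (formal_sums M N)"
  using assms by auto

lemma tensor_eq_smult_add_left:
  assumes "s \<in> carrier (formal_sums M N)"
  shows "tensor_eq M N (image_mset (\<lambda>(x, y). ((b + c) \<odot>\<^bsub>M\<^esub> x, y)) s)
    (image_mset (\<lambda>(x, y). (b \<odot>\<^bsub>M\<^esub> x, y)) s + image_mset (\<lambda>(x, y). (c \<odot>\<^bsub>M\<^esub> x, y)) s)"
  using assms
proof (induction s)
  case empty
  then show ?case by (auto intro: tensor_eq.refl)
next
  case (add p s)
  obtain x y where p: "p = (x, y)" by (cases p)
  note split = formal_sum_split[OF add.prems[unfolded p]]
  have "tensor_eq M N {#((b + c) \<odot>\<^bsub>M\<^esub> x, y)#} {#(b \<odot>\<^bsub>M\<^esub> x, y), (c \<odot>\<^bsub>M\<^esub> x, y)#}"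
    using split by (simp add: M.smult_add_left tensor_eq.add_left M.smult_closed)
  from tensor_eq_add_both[OF this add.IH[OF split(3)]] show ?case
    by (simp add: p add_mset_commute)
qed

lemma tensor_eq_zero_smult:
  assumes "s \<in> carrier (formal_sums M N)"
  shows "tensor_eq M N (image_mset (\<lambda>(x, y). (0 \<odot>\<^bsub>M\<^esub> x, y)) s) {#}"
  using assms
proof (induction s)
  case empty
  then show ?case by (auto intro: tensor_eq.refl)
next
  case (add p s)
  obtain x y where p: "p = (x, y)" by (cases p)
  note split = formal_sum_split[OF add.prems[unfolded p]]
  have "tensor_eq M N {#(0 \<odot>\<^bsub>M\<^esub> x, y)#} {#}"
    using split by (simp add: M.zero_smult tensor_eq.zero_left)
  from tensor_eq_add_both[OF this add.IH[OF split(3)]] show ?case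
    by (simp add: p)
qed

lemma tensor_eq_equiv:
  "tensor_eq M N s t \<Longrightarrow> (s, t) \<in> preorder_equiv (formal_sums M N) (tensor_le M N)"
  using tensor_eq_carrier unfolding preorder_equiv_def
  by (blast intro: tensor_le.eq tensor_eq.sym)

lemma smult_smult_formal:
  assumes "s \<in> carrier (formal_sums M N)"
  shows "image_mset (\<lambda>(x, y). ((b * c) \<odot>\<^bsub>M\<^esub> x, y)) s =
    image_mset (\<lambda>(x, y). (b \<odot>\<^bsub>M\<^esub> x, y)) (image_mset (\<lambda>(x, y). (c \<odot>\<^bsub>M\<^esub> x, y)) s)"
  using assms by (auto simp: image_mset.compositionality M.smult_smult intro!: image_mset_cong)

lemma one_smult_formal:
  assumes "s \<in> carrier (formal_sums M N)"
  shows "image_mset (\<lambda>(x, y). (1 \<odot>\<^bsub>M\<^esub> x, y)) s = s"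
proof -
  have "image_mset (\<lambda>(x, y). (1 \<odot>\<^bsub>M\<^esub> x, y)) s = image_mset id s"
    using assms by (intro image_mset_cong) (auto simp: M.one_smult)
  then show ?thesis by simp
qed

sublocale FS: preordered_semimodule "formal_sums M N" "tensor_le M N"
proof (intro preordered_semimodule.intro preordered_semimodule_axioms.intro)
  show "abelian_monoid (formal_sums M N)"
    by (rule abelian_monoidI) (auto simp: ac_simps)
next
  fix s t and b c :: 'a assume "b \<le> c" "tensor_le M N s t"
  then show "tensor_le M N (b \<odot>\<^bsub>formal_sums M N\<^esub> s) (c \<odot>\<^bsub>formal_sums M N\<^esub> t)"
    by (rule tensor_le.smult)
next
  fix s t u assume "tensor_le M N s t" "tensor_le M N t u"
  then show "tensor_le M N s u" by (rule tensor_le.trans)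
next
  fix s t u assume "tensor_le M N s t" "u \<in> carrier (formal_sums M N)"
  then show "tensor_le M N (s \<oplus>\<^bsub>formal_sums M N\<^esub> u) (t \<oplus>\<^bsub>formal_sums M N\<^esub> u)"
    using tensor_le.add by fastforce
next
  fix s and b :: 'a assume "s \<in> carrier (formal_sums M N)"
  then show "b \<odot>\<^bsub>formal_sums M N\<^esub> s \<in> carrier (formal_sums M N)"
    by (auto simp: M.smult_closed)
next
  fix s assume s: "s \<in> carrier (formal_sums M N)"
  show "(0 \<odot>\<^bsub>formal_sums M N\<^esub> s, \<zero>\<^bsub>formal_sums M N\<^esub>)
      \<in> preorder_equiv (formal_sums M N) (tensor_le M N)"
    using tensor_eq_equiv[OF tensor_eq_zero_smult[OF s]] by simp
  show "(1 \<odot>\<^bsub>formal_sums M N\<^esub> s, s) \<in> preorder_equiv (formal_sums M N) (tensor_le M N)"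
    unfolding formal_sums_simps one_smult_formal[OF s] by (rule tensor_eq_equiv[OF tensor_eq.refl[OF s]])
  fix b c :: 'a
  show "((b + c) \<odot>\<^bsub>formal_sums M N\<^esub> s, b \<odot>\<^bsub>formal_sums M N\<^esub> s \<oplus>\<^bsub>formal_sums M N\<^esub> c \<odot>\<^bsub>formal_sums M N\<^esub> s)
      \<in> preorder_equiv (formal_sums M N) (tensor_le M N)"
    using tensor_eq_equiv[OF tensor_eq_smult_add_left[OF s]] by simp
  show "((b * c) \<odot>\<^bsub>formal_sums M N\<^esub> s, b \<odot>\<^bsub>formal_sums M N\<^esub> (c \<odot>\<^bsub>formal_sums M N\<^esub> s))
      \<in> preorder_equiv (formal_sums M N) (tensor_le M N)"
    unfolding formal_sums_simps smult_smult_formal[OF s]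
    by (intro tensor_eq_equiv tensor_eq.refl) (use s in \<open>auto simp: M.smult_closed\<close>)
next
  fix s t and b :: 'a assume "s \<in> carrier (formal_sums M N)" "t \<in> carrier (formal_sums M N)"
  then show "(b \<odot>\<^bsub>formal_sums M N\<^esub> (s \<oplus>\<^bsub>formal_sums M N\<^esub> t),
      b \<odot>\<^bsub>formal_sums M N\<^esub> s \<oplus>\<^bsub>formal_sums M N\<^esub> b \<odot>\<^bsub>formal_sums M N\<^esub> t)
      \<in> preorder_equiv (formal_sums M N) (tensor_le M N)"
    by (intro tensor_eq_equiv) (auto simp: M.smult_closed subset_iff intro!: tensor_eq.refl)
next
  fix s t assume "tensor_le M N s t"
  then show "s \<in> carrier (formal_sums M N) \<and> t \<in> carrier (formal_sums M N)"
    by (rule tensor_le_carrier)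
next
  fix s assume "s \<in> carrier (formal_sums M N)"
  then show "tensor_le M N s s" by (intro tensor_le.eq tensor_eq.refl)
next
  fix b :: 'a
  show "(b \<odot>\<^bsub>formal_sums M N\<^esub> \<zero>\<^bsub>formal_sums M N\<^esub>, \<zero>\<^bsub>formal_sums M N\<^esub>)
      \<in> preorder_equiv (formal_sums M N) (tensor_le M N)"
    using tensor_eq_equiv[OF tensor_eq.refl[of "{#}"]] by simp
qed

end

text \<open>
  The tensor product is functorial in its first factor. The induced map of formal sums depends
  additively and monotonically on the map \<open>h\<close>; this is used with $h = x \cdot -$ for
  varying $x$.
\<close>

locale tensor_factors_map = tensor_factors M N + M': ordered_semimodule M'
  for M :: "('a::ord_comm_semiring, 'm) blue_struct" and N :: "('a, 'k) blue_struct"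
    and M' :: "('a, 'l) blue_struct"
begin

sublocale codomain: tensor_factors M' N ..

lemma tensor_eq_map:
  assumes "monotone_linear M M' h" "tensor_eq M N s t"
  shows "tensor_eq M' N (image_mset (\<lambda>(z, v). (h z, v)) s) (image_mset (\<lambda>(z, v). (h z, v)) t)"
proof -
  interpret h: monotone_linear M M' h by fact
  have closed: "image_mset (\<lambda>(z, v). (h z, v)) s \<in> carrier (formal_sums M' N)"
    if "s \<in> carrier (formal_sums M N)" for s
    using that h.map_closed by auto
  from assms(2) show ?thesis
  proof induction
    case (trans s t u)
    then show ?case using tensor_eq.trans by blast
  qed (use closed in \<open>auto simp: h.map_closed h.map_add h.map_smult h.map_zero
      simp del: formal_sums_simps intro: tensor_eq.intros\<close>)
qed

lemma tensor_le_map: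
  assumes "monotone_linear M M' h" "tensor_le M N s t"
  shows "tensor_le M' N (image_mset (\<lambda>(z, v). (h z, v)) s) (image_mset (\<lambda>(z, v). (h z, v)) t)"
proof -
  interpret h: monotone_linear M M' h by fact
  have closed: "image_mset (\<lambda>(z, v). (h z, v)) s \<in> carrier (formal_sums M' N)"
    if "s \<in> carrier (formal_sums M N)" for s
    using that h.map_closed by auto
  have map_smult: "image_mset (\<lambda>(z, v). (h z, v)) (b \<odot>\<^bsub>formal_sums M N\<^esub> s)
      = b \<odot>\<^bsub>formal_sums M' N\<^esub> image_mset (\<lambda>(z, v). (h z, v)) s"
    if "s \<in> carrier (formal_sums M N)" for b s
    using that by (auto simp: image_mset.compositionality h.map_smult intro!: image_mset_cong)
  from assms(2) show ?thesis
  proof induction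
    case (eq s t)
    then show ?case using tensor_eq_map[OF assms(1)] tensor_le.eq by blast
  next
    case (trans s t u)
    show ?case by (rule tensor_le.trans[OF trans.IH])
  next
    case (add s t u)
    then show ?case using closed by (simp del: formal_sums_simps add: tensor_le.add)
  next
    case (smult b c s t)
    then show ?case
      using tensor_le_carrier[OF smult.hyps(2)] by (simp only: map_smult tensor_le.smult)
  next
    case (tensor x x' y y')
    then show ?case by (simp add: h.map_closed h.map_mono tensor_le.tensor)
  qed
qed

lemma tensor_le_map_mono:
  assumes "\<And>z. z \<in> carrier M \<Longrightarrow> h z \<in> carrier M'" "\<And>z. z \<in> carrier M \<Longrightarrow> h' z \<in> carrier M'"
    and "\<And>z. z \<in> carrier M \<Longrightarrow> leq M' (h z) (h' z)" and "s \<in> carrier (formal_sums M N)"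
  shows "tensor_le M' N (image_mset (\<lambda>(z, v). (h z, v)) s) (image_mset (\<lambda>(z, v). (h' z, v)) s)"
  using assms(4)
proof (induction s)
  case empty
  then show ?case by (simp add: tensor_eq.refl tensor_le.eq)
next
  case (add p s)
  obtain z v where p: "p = (z, v)" by (cases p)
  note split = formal_sum_split[OF add.prems[unfolded p]]
  have "tensor_le M' N {#(h z, v)#} {#(h' z, v)#}"
    using split assms N.leq_refl by (intro tensor_le.tensor) auto
  from codomain.FS.r_add_both[OF this add.IH[OF split(3)]] show ?case
    by (simp add: p)
qed

lemma tensor_eq_map_add:
  assumes "\<And>z. z \<in> carrier M \<Longrightarrow> h z \<in> carrier M'" "\<And>z. z \<in> carrier M \<Longrightarrow> h' z \<in> carrier M'"
    and "s \<in> carrier (formal_sums M N)"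
  shows "tensor_eq M' N (image_mset (\<lambda>(z, v). (h z \<oplus>\<^bsub>M'\<^esub> h' z, v)) s)
    (image_mset (\<lambda>(z, v). (h z, v)) s + image_mset (\<lambda>(z, v). (h' z, v)) s)"
  using assms(3)
proof (induction s)
  case empty
  then show ?case by (auto intro: tensor_eq.refl)
next
  case (add p s)
  obtain z v where p: "p = (z, v)" by (cases p)
  note split = formal_sum_split[OF add.prems[unfolded p]]
  have "tensor_eq M' N {#(h z \<oplus>\<^bsub>M'\<^esub> h' z, v)#} {#(h z, v), (h' z, v)#}"
    using split assms by (intro tensor_eq.add_left) auto
  from codomain.tensor_eq_add_both[OF this add.IH[OF split(3)]] show ?case
    by (simp add: p add_mset_commute)
qed

lemma tensor_eq_map_zero:
  assumes "s \<in> carrier (formal_sums M N)"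
  shows "tensor_eq M' N (image_mset (\<lambda>(z, v). (\<zero>\<^bsub>M'\<^esub>, v)) s) {#}"
  using assms
proof (induction s)
  case empty
  then show ?case by (auto intro: tensor_eq.refl)
next
  case (add p s)
  obtain z v where p: "p = (z, v)" by (cases p)
  note split = formal_sum_split[OF add.prems[unfolded p]]
  have "tensor_eq M' N {#(\<zero>\<^bsub>M'\<^esub>, v)#} {#}"
    using split by (intro tensor_eq.zero_left) auto
  from codomain.tensor_eq_add_both[OF this add.IH[OF split(3)]] show ?case
    by (simp add: p)
qed

end


section \<open>Tensor powers of the free module\<close>

lemma mult_mono_all:
  fixes a b c d :: "'a::ord_comm_semiring"
  assumes "a \<le> b" "c \<le> d"
  shows "a * c \<le> b * d"
proof -
  have "a * c \<le> b * c" using assms(1) by (rule mult_right_mono_all)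
  also have "\<dots> \<le> b * d" using mult_right_mono_all[OF assms(2), of b] by (simp add: mult.commute)
  finally show ?thesis .
qed

lemma base_module_simps [simp]:
  "carrier (base_module Bp) = UNIV" "\<zero>\<^bsub>base_module Bp\<^esub> = 0"
  "x \<oplus>\<^bsub>base_module Bp\<^esub> y = x + y" "b \<odot>\<^bsub>base_module Bp\<^esub> x = b * x"
  "leq (base_module Bp) x y \<longleftrightarrow> x \<le> y" "pts (base_module Bp) = Bp"
  by (simp_all add: base_module_def)

lemma ordered_semimodule_base: "ordered_semimodule (base_module Bp)"
proof (intro ordered_semimodule.intro)
  show "abelian_monoid (base_module Bp)"
    by (rule abelian_monoidI) (auto simp: ac_simps)
  show "ordered_semimodule_axioms (base_module Bp)"
    by unfold_locales (auto simp: distrib_left distrib_right mult.assoc add_right_mono mult_mono_all)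
qed

lemma free_module_simps [simp]:
  "carrier (free_module Bp n) = {v. \<forall>i. i \<notin> {1..n} \<longrightarrow> v i = 0}"
  "\<zero>\<^bsub>free_module Bp n\<^esub> = (\<lambda>_. 0)"
  "v \<oplus>\<^bsub>free_module Bp n\<^esub> w = (\<lambda>i. v i + w i)"
  "b \<odot>\<^bsub>free_module Bp n\<^esub> v = (\<lambda>i. b * v i)"
  "leq (free_module Bp n) v w \<longleftrightarrow> (\<forall>i\<in>{1..n}. v i \<le> w i)"
  "pts (free_module Bp n) = {v. (\<forall>i. i \<notin> {1..n} \<longrightarrow> v i = 0) \<and> (\<forall>i\<in>{1..n}. v i \<in> Bp)}"
  by (simp_all add: free_module_def)

lemma ordered_semimodule_free: "ordered_semimodule (free_module Bp n)"
proof (intro ordered_semimodule.intro)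
  show "abelian_monoid (free_module Bp n)"
    by (rule abelian_monoidI) (auto simp: ac_simps)
  show "ordered_semimodule_axioms (free_module Bp n)"
  proof (unfold_locales, goal_cases)
    \<comment> \<open>antisymmetry of the order\<close>
    case (9 v w)
    show ?case
    proof
      fix i show "v i = w i" using 9 by (cases "i \<in> {1..n}") (auto intro: antisym)
    qed
  next
    \<comment> \<open>transitivity of the order\<close>
    case (10 u v w)
    show ?case
      unfolding free_module_simps
    proof
      fix i assume "i \<in> {1..n}"
      then show "u i \<le> w i" using 10(4,5) order_trans[of "u i" "v i" "w i"] by simp
    qed
  qed (auto simp: distrib_left distrib_right mult.assoc add_right_mono mult_mono_all fun_eq_iff)
qed

lemma base_module_blue:
  assumes "ordered_blueprint Bp"
  shows "blue_module Bp (base_module Bp)"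
proof -
  interpret B: ordered_blueprint Bp by fact
  interpret ordered_semimodule "base_module Bp" by (rule ordered_semimodule_base)
  have "x \<in> submodule_span (base_module Bp) Bp" for x
    using submodule_span.smult[OF submodule_span.incl[OF B.one_mem], of "base_module Bp" x] by simp
  then have "submodule_span (base_module Bp) Bp = UNIV" by blast
  with blue_module_span[OF assms, of Bp] show ?thesis
    by (simp add: B.zero_mem B.mult_mem) (simp add: base_module_def)
qed

lemma free_module_blue:
  assumes "ordered_blueprint Bp"
  shows "blue_module Bp (free_module Bp n)"
proof -
  interpret B: ordered_blueprint Bp by fact
  let ?F = "free_module Bp n"
  interpret F: ordered_semimodule ?F by (rule ordered_semimodule_free)
  have gen: "basis_vec i \<in> pts ?F" if "i \<in> {1..n}" for i
    using that by (auto simp: basis_vec_def B.zero_mem B.one_mem)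
  \<comment> \<open>Induction on the support, splitting off the last coordinate.\<close>
  have span: "m \<le> n \<Longrightarrow> \<forall>i. i \<notin> {1..m} \<longrightarrow> v i = 0 \<Longrightarrow> v \<in> submodule_span ?F (pts ?F)" for m v
  proof (induction m arbitrary: v)
    case 0
    then have "v = \<zero>\<^bsub>?F\<^esub>" by auto
    then show ?case by (metis submodule_span.zero)
  next
    case (Suc m)
    have "v(Suc m := 0) \<in> submodule_span ?F (pts ?F)"
      using Suc.prems by (intro Suc.IH) (auto simp: le_Suc_eq)
    moreover have "v (Suc m) \<odot>\<^bsub>?F\<^esub> basis_vec (Suc m) \<in> submodule_span ?F (pts ?F)"
      using Suc.prems by (intro submodule_span.smult submodule_span.incl gen) auto
    ultimately have "v(Suc m := 0) \<oplus>\<^bsub>?F\<^esub> (v (Suc m) \<odot>\<^bsub>?F\<^esub> basis_vec (Suc m))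
        \<in> submodule_span ?F (pts ?F)"
      by (rule submodule_span.add)
    moreover have "v(Suc m := 0) \<oplus>\<^bsub>?F\<^esub> (v (Suc m) \<odot>\<^bsub>?F\<^esub> basis_vec (Suc m)) = v"
      by (auto simp: basis_vec_def fun_eq_iff)
    ultimately show ?case by simp
  qed
  have "submodule_span ?F (pts ?F) = carrier ?F"
  proof (intro equalityI subsetI)
    fix v assume "v \<in> submodule_span ?F (pts ?F)"
    then show "v \<in> carrier ?F" by (rule F.span_closed[rotated]) auto
  next
    fix v assume "v \<in> carrier ?F"
    then show "v \<in> submodule_span ?F (pts ?F)" by (intro span[of n]) simp_all
  qed
  moreover have "blue_module Bp (?F\<lparr>carrier := submodule_span ?F (pts ?F), pts := pts ?F\<rparr>)"
    by (rule F.blue_module_span[OF assms]) (auto simp: B.zero_mem B.mult_mem)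
  ultimately show ?thesis by (simp add: free_module_def)
qed

lemma zero_module_blue:
  assumes "ordered_blueprint Bp"
  shows "blue_module Bp zero_module"
proof -
  have "abelian_monoid zero_module"
    by (rule abelian_monoidI) (simp_all add: zero_module_def)
  moreover have "blue_module_axioms Bp zero_module"
    by unfold_locales (auto simp: zero_module_def reflp_on_def antisymp_on_def transp_on_def
        intro: exI[of _ "[]"])
  ultimately show ?thesis using assms by (intro blue_module.intro)
qed

text \<open>
  The representative chosen by \<^const>\<open>encode\<close> lies in the class it represents, and distinct
  classes are disjoint.
\<close>

lemma inj_encode:
  fixes M :: "('a::ord_comm_semiring, 'a tens) blue_struct" and N :: "('a, nat \<Rightarrow> 'a) blue_struct"
  assumes "tensor_factors M N"
  shows "inj_on encode (carrier (tensor_prod M N))"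
proof (rule inj_onI)
  interpret tensor_factors M N by fact
  fix X Y :: "('a tens \<times> (nat \<Rightarrow> 'a)) multiset set"
  assume XY: "X \<in> carrier (tensor_prod M N)" "Y \<in> carrier (tensor_prod M N)"
    and "encode X = encode Y"
  then have eq: "(SOME s. s \<in> X) = (SOME s. s \<in> Y)" by (simp add: encode_def)
  have quot: "X \<in> carrier (formal_sums M N) // preorder_equiv (formal_sums M N) (tensor_le M N)"
      "Y \<in> carrier (formal_sums M N) // preorder_equiv (formal_sums M N) (tensor_le M N)"
    using XY by (simp_all add: tensor_prod_def preorder_quot_def Let_def)
  then have "(SOME s. s \<in> X) \<in> X" "(SOME s. s \<in> Y) \<in> Y"
    using in_quotient_imp_non_empty[OF FS.equiv_preorder] some_in_eq by blast+
  with quot eq show "X = Y"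
    using quotient_disj[OF FS.equiv_preorder quot] by auto
qed

declare tensor_power.simps [simp del]

locale tensor_powers =
  fixes Bp :: "'a::ord_comm_semiring set" and n :: nat
begin

abbreviation P :: "nat \<Rightarrow> ('a, 'a tens) blue_struct" where
  "P \<equiv> tensor_power Bp n"

abbreviation F :: "('a, nat \<Rightarrow> 'a) blue_struct" where
  "F \<equiv> free_module Bp n"

lemma ordered_semimodule_power: "ordered_semimodule (P l)"
proof (induction l)
  case 0
  show ?case
    by (simp add: tensor_power.simps ordered_semimodule_base ordered_semimodule_transport inj_on_def)
next
  case (Suc l)
  then interpret tensor_factors "P l" F
    by (intro tensor_factors.intro ordered_semimodule_free)
  show ?case
    using ordered_semimodule_transport[OF inj_encode[OF tensor_factors_axioms]]
      FS.ordered_semimodule_quot by (simp add: tensor_power.simps tensor_prod_def)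
qed

sublocale P: ordered_semimodule "P l" for l
  by (rule ordered_semimodule_power)

lemma tensor_factors_power: "tensor_factors (P l) F"
  by (intro tensor_factors.intro ordered_semimodule_power ordered_semimodule_free)

lemma tensor_power_0_simps [simp]:
  "carrier (P 0) = range Scal" "\<zero>\<^bsub>P 0\<^esub> = Scal 0"
  "Scal a \<oplus>\<^bsub>P 0\<^esub> Scal b = Scal (a + b)" "b \<odot>\<^bsub>P 0\<^esub> Scal a = Scal (b * a)"
  "leq (P 0) (Scal a) (Scal b) \<longleftrightarrow> a \<le> b"
proof -
  have "inj_on Scal (carrier (base_module Bp))" by (simp add: inj_on_def)
  from transport_simps[OF this]
  show "carrier (P 0) = range Scal" "\<zero>\<^bsub>P 0\<^esub> = Scal 0"
    "Scal a \<oplus>\<^bsub>P 0\<^esub> Scal b = Scal (a + b)" "b \<odot>\<^bsub>P 0\<^esub> Scal a = Scal (b * a)"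
    "leq (P 0) (Scal a) (Scal b) \<longleftrightarrow> a \<le> b"
    by (simp_all add: tensor_power.simps)
qed

abbreviation sums :: "nat \<Rightarrow> ('a tens \<times> (nat \<Rightarrow> 'a)) multiset set" where
  "sums l \<equiv> carrier (formal_sums (P l) F)"

lemma tensor_power_Suc_simps:
  shows "carrier (P (Suc l)) = tensor_class Bp n l ` sums l"
    and "\<zero>\<^bsub>P (Suc l)\<^esub> = tensor_class Bp n l {#}"
    and "s \<in> sums l \<Longrightarrow> t \<in> sums l \<Longrightarrow>
      tensor_class Bp n l s \<oplus>\<^bsub>P (Suc l)\<^esub> tensor_class Bp n l t = tensor_class Bp n l (s + t)"
    and "s \<in> sums l \<Longrightarrow> b \<odot>\<^bsub>P (Suc l)\<^esub> tensor_class Bp n l s =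
      tensor_class Bp n l (image_mset (\<lambda>(z, v). (b \<odot>\<^bsub>P l\<^esub> z, v)) s)"
    and "s \<in> sums l \<Longrightarrow> t \<in> sums l \<Longrightarrow>
      leq (P (Suc l)) (tensor_class Bp n l s) (tensor_class Bp n l t) \<longleftrightarrow> tensor_le (P l) F s t"
proof -
  interpret tensor_factors "P l" F by (rule tensor_factors_power)
  let ?Q = "tensor_prod (P l) F"
  note simps = transport_simps[OF inj_encode[OF tensor_factors_axioms], folded tensor_power.simps]
  have class_eq: "tensor_class Bp n l s = encode (FS.cls s)" for s
    by (simp add: tensor_class_def Let_def)
  note quot = FS.quot_simps[folded tensor_prod_def]
  have mem: "FS.cls s \<in> carrier ?Q" if "s \<in> sums l" for s
    unfolding quot using that by (rule imageI)
  show "carrier (P (Suc l)) = tensor_class Bp n l ` sums l"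
    unfolding simps quot class_eq by (rule image_image)
  show "\<zero>\<^bsub>P (Suc l)\<^esub> = tensor_class Bp n l {#}"
    unfolding simps quot class_eq by simp
  show "leq (P (Suc l)) (tensor_class Bp n l s) (tensor_class Bp n l t) \<longleftrightarrow> tensor_le (P l) F s t"
    if "s \<in> sums l" "t \<in> sums l" for s t
    unfolding class_eq simps(5)[OF mem[OF that(1)] mem[OF that(2)]] by (rule quot(5)[OF that])
  show "tensor_class Bp n l s \<oplus>\<^bsub>P (Suc l)\<^esub> tensor_class Bp n l t = tensor_class Bp n l (s + t)"
    if "s \<in> sums l" "t \<in> sums l" for s t
    unfolding class_eq simps(3)[OF mem[OF that(1)] mem[OF that(2)]] quot(3)[OF that] by simp
  show "b \<odot>\<^bsub>P (Suc l)\<^esub> tensor_class Bp n l s =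
      tensor_class Bp n l (image_mset (\<lambda>(z, v). (b \<odot>\<^bsub>P l\<^esub> z, v)) s)"
    if "s \<in> sums l" for b s
    unfolding class_eq simps(4)[OF mem[OF that(1)]] quot(4)[OF that] by simp
qed

lemma tensor_class_eqI:
  assumes "tensor_le (P l) F s t" "tensor_le (P l) F t s"
  shows "tensor_class Bp n l s = tensor_class Bp n l t"
proof -
  interpret tensor_factors "P l" F by (rule tensor_factors_power)
  have "(s, t) \<in> preorder_equiv (formal_sums (P l) F) (tensor_le (P l) F)"
    using assms tensor_le_carrier[OF assms(1)]
    by (simp only: preorder_equiv_def mem_Collect_eq prod.case simp_thms)
  from FS.cls_eqI[OF this] show ?thesis by (simp add: tensor_class_def Let_def)
qed

lemma tensor_class_eqI':
  "tensor_eq (P l) F s t \<Longrightarrow> tensor_class Bp n l s = tensor_class Bp n l t"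
  by (rule tensor_class_eqI; rule tensor_le.eq) (auto intro: tensor_eq.sym)

lemma tensor_class_rep:
  assumes "s \<in> sums l"
  shows "\<exists>t. tensor_class Bp n l s = Tens t \<and> tensor_le (P l) F s t \<and> tensor_le (P l) F t s"
proof -
  interpret tensor_factors "P l" F by (rule tensor_factors_power)
  define t where "t = (SOME t. t \<in> FS.cls s)"
  have "s \<in> FS.cls s" using FS.equiv_preorder assms by (rule equiv_class_self)
  then have "t \<in> FS.cls s" unfolding t_def by (rule someI)
  then have "tensor_le (P l) F s t" "tensor_le (P l) F t s"
    by (auto simp only: preorder_equiv_def Image_singleton_iff mem_Collect_eq prod.case)
  moreover have "tensor_class Bp n l s = Tens t"
    by (simp add: tensor_class_def encode_def Let_def t_def)
  ultimately show ?thesis by blast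
qed

abbreviation conc :: "nat \<Rightarrow> nat \<Rightarrow> 'a tens \<Rightarrow> 'a tens \<Rightarrow> 'a tens" where
  "conc \<equiv> tensor_concat Bp n"

lemma tensor_factors_map_power: "tensor_factors_map (P l) F (P k)"
  by (intro tensor_factors_map.intro tensor_factors_power ordered_semimodule_power)

lemma map_sums:
  assumes "s \<in> sums l" "\<And>z. z \<in> carrier (P l) \<Longrightarrow> h z \<in> carrier (P k)"
  shows "image_mset (\<lambda>(z, v). (h z, v)) s \<in> sums k"
  using assms by (auto simp: subset_iff)

text \<open>
  Concatenation is defined on representatives. That it is well defined and that it is linear and
  monotone in its second argument are proved by a common induction on the degree of this argument,
  since passing from degree $l$ to $l + 1$ applies the functor $- \otimes B^n$ to
  $x \cdot -$.
\<close>

lemma tensor_concat_class: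
  assumes "monotone_linear (P l) (P (k + l)) (conc k l x)" "s \<in> sums l"
  shows "conc k (Suc l) x (tensor_class Bp n l s)
    = tensor_class Bp n (k + l) (image_mset (\<lambda>(z, v). (conc k l x z, v)) s)"
proof -
  interpret tensor_factors_map "P l" F "P (k + l)" by (rule tensor_factors_map_power)
  obtain t where t: "tensor_class Bp n l s = Tens t" "tensor_le (P l) F s t" "tensor_le (P l) F t s"
    using tensor_class_rep[OF assms(2)] by blast
  show ?thesis
    unfolding t(1) tensor_concat.simps
    by (intro tensor_class_eqI tensor_le_map assms(1) t)
qed

lemma monotone_linear_concat_Suc:
  assumes "monotone_linear (P l) (P (k + l)) (conc k l x)"
  shows "monotone_linear (P (Suc l)) (P (k + Suc l)) (conc k (Suc l) x)"
proof -
  interpret tensor_factors_map "P l" F "P (k + l)" by (rule tensor_factors_map_power)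
  interpret c: monotone_linear "P l" "P (k + l)" "conc k l x" by fact
  let ?h = "\<lambda>s. image_mset (\<lambda>(z, v). (conc k l x z, v)) s"
  note conc_cls = tensor_concat_class[OF assms]
  have closed: "?h s \<in> sums (k + l)" if "s \<in> sums l" for s
    using that c.map_closed by (rule map_sums)
  have smult: "?h (image_mset (\<lambda>(z, v). (b \<odot>\<^bsub>P l\<^esub> z, v)) s)
      = image_mset (\<lambda>(z, v). (b \<odot>\<^bsub>P (k + l)\<^esub> z, v)) (?h s)" if "s \<in> sums l" for b s
    using that by (auto simp: image_mset.compositionality c.map_smult intro!: image_mset_cong)
  have sum_closed: "s + t \<in> sums l" if "s \<in> sums l" "t \<in> sums l" for s t
    using that by auto
  have smult_closed: "image_mset (\<lambda>(z, v). (b \<odot>\<^bsub>P l\<^esub> z, v)) s \<in> sums l" if "s \<in> sums l" for b s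
    using that P.smult_closed by (rule map_sums)
  show ?thesis
  proof
    show "conc k (Suc l) x \<zero>\<^bsub>P (Suc l)\<^esub> = \<zero>\<^bsub>P (k + Suc l)\<^esub>"
      using conc_cls[of "{#}"] by (simp add: tensor_power_Suc_simps(2))
    fix y assume "y \<in> carrier (P (Suc l))"
    then obtain s where s: "s \<in> sums l" "y = tensor_class Bp n l s"
      unfolding tensor_power_Suc_simps by blast
    show "conc k (Suc l) x y \<in> carrier (P (k + Suc l))"
      unfolding add_Suc_right tensor_power_Suc_simps s(2) conc_cls[OF s(1)]
      using closed[OF s(1)] by (rule imageI)
    show "conc k (Suc l) x (b \<odot>\<^bsub>P (Suc l)\<^esub> y) = b \<odot>\<^bsub>P (k + Suc l)\<^esub> conc k (Suc l) x y" for b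
      unfolding s(2) add_Suc_right tensor_power_Suc_simps(4)[OF s(1)] conc_cls[OF s(1)]
        conc_cls[OF smult_closed[OF s(1)]] tensor_power_Suc_simps(4)[OF closed[OF s(1)]] smult[OF s(1)]
      by simp
    fix y' assume "y' \<in> carrier (P (Suc l))"
    then obtain t where t: "t \<in> sums l" "y' = tensor_class Bp n l t"
      unfolding tensor_power_Suc_simps by blast
    show "conc k (Suc l) x (y \<oplus>\<^bsub>P (Suc l)\<^esub> y')
        = conc k (Suc l) x y \<oplus>\<^bsub>P (k + Suc l)\<^esub> conc k (Suc l) x y'"
      unfolding s(2) t(2) add_Suc_right tensor_power_Suc_simps(3)[OF s(1) t(1)] conc_cls[OF s(1)]
        conc_cls[OF t(1)] conc_cls[OF sum_closed[OF s(1) t(1)]]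
        tensor_power_Suc_simps(3)[OF closed[OF s(1)] closed[OF t(1)]] image_mset_union
      by simp
    show "leq (P (k + Suc l)) (conc k (Suc l) x y) (conc k (Suc l) x y')"
      if "leq (P (Suc l)) y y'"
      using that
      unfolding s(2) t(2) add_Suc_right conc_cls[OF s(1)] conc_cls[OF t(1)]
        tensor_power_Suc_simps(5)[OF closed[OF s(1)] closed[OF t(1)]]
        tensor_power_Suc_simps(5)[OF s(1) t(1)]
      by (rule tensor_le_map[OF assms])
  qed
qed

lemma monotone_linear_concat_right:
  assumes "x \<in> carrier (P k)"
  shows "monotone_linear (P l) (P (k + l)) (conc k l x)"
proof (induction l)
  case 0
  show ?case
    using assms
    by unfold_locales
       (auto simp: P.smult_closed P.zero_smult P.smult_add_left
          P.smult_smult P.leq_smult P.leq_refl)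
next
  case (Suc l)
  then show ?case by (rule monotone_linear_concat_Suc)
qed

lemmas concat_class = tensor_concat_class[OF monotone_linear_concat_right]

text \<open>
  On formal sums $s = \sum_j z_j \otimes v_j$, the product $x \cdot s$ is obtained by applying
  $z \mapsto x \cdot z$ to all $z_j$; so its dependence on $x$ is that of the $x \cdot z_j$.
\<close>

lemma monotone_linear_concat_left:
  assumes "y \<in> carrier (P l)"
  shows "monotone_linear (P k) (P (k + l)) (\<lambda>x. conc k l x y)"
  using assms
proof (induction l arbitrary: y)
  case 0
  obtain a where "y = Scal a" using 0 by auto
  then show ?case
    by unfold_locales
       (auto simp: P.smult_closed P.smult_zero P.smult_add_right
          P.leq_smult mult.commute simp flip: P.smult_smult)
next
  case (Suc l)
  interpret tensor_factors_map "P l" F "P (k + l)" by (rule tensor_factors_map_power)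
  obtain s where s: "s \<in> sums l" "y = tensor_class Bp n l s"
    using Suc.prems unfolding tensor_power_Suc_simps by blast
  let ?h = "\<lambda>x. image_mset (\<lambda>(z, v). (conc k l x z, v)) s"
  have conc_cls: "conc k (Suc l) x y = tensor_class Bp n (k + l) (?h x)"
    if "x \<in> carrier (P k)" for x
    unfolding s(2) using that s(1) by (rule concat_class)
  note IH = monotone_linear.map_closed[OF Suc.IH] monotone_linear.map_zero[OF Suc.IH]
    monotone_linear.map_add[OF Suc.IH] monotone_linear.map_smult[OF Suc.IH]
    monotone_linear.map_mono[OF Suc.IH]
  have mem: "z \<in> carrier (P l)" if "(z, v) \<in># s" for z v using s(1) that by auto
  have closed: "?h x \<in> sums (k + l)" if "x \<in> carrier (P k)" for x
    using s(1) IH(1) that by (intro map_sums)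
  show ?case
  proof
    have "?h \<zero>\<^bsub>P k\<^esub> = image_mset (\<lambda>(z, v). (\<zero>\<^bsub>P (k + l)\<^esub>, v)) s"
      by (rule image_mset_cong) (auto simp: IH(2) mem)
    with tensor_class_eqI'[OF tensor_eq_map_zero[OF s(1)]]
    show "conc k (Suc l) \<zero>\<^bsub>P k\<^esub> y = \<zero>\<^bsub>P (k + Suc l)\<^esub>"
      unfolding conc_cls[OF P.zero_closed] add_Suc_right tensor_power_Suc_simps(2) by simp
    fix x assume x: "x \<in> carrier (P k)"
    show "conc k (Suc l) x y \<in> carrier (P (k + Suc l))"
      unfolding add_Suc_right tensor_power_Suc_simps conc_cls[OF x] using closed[OF x] by (rule imageI)
    show "conc k (Suc l) (b \<odot>\<^bsub>P k\<^esub> x) y = b \<odot>\<^bsub>P (k + Suc l)\<^esub> conc k (Suc l) x y" for b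
    proof -
      have "?h (b \<odot>\<^bsub>P k\<^esub> x) = image_mset (\<lambda>(z, v). (b \<odot>\<^bsub>P (k + l)\<^esub> z, v)) (?h x)"
        unfolding image_mset.compositionality
        by (rule image_mset_cong) (auto simp: IH(4) mem x)
      then show ?thesis
        unfolding conc_cls[OF x] conc_cls[OF P.smult_closed[OF x]] add_Suc_right
          tensor_power_Suc_simps(4)[OF closed[OF x]] by simp
    qed
    fix x' assume x': "x' \<in> carrier (P k)"
    show "conc k (Suc l) (x \<oplus>\<^bsub>P k\<^esub> x') y
        = conc k (Suc l) x y \<oplus>\<^bsub>P (k + Suc l)\<^esub> conc k (Suc l) x' y"
    proof -
      have "?h (x \<oplus>\<^bsub>P k\<^esub> x')
          = image_mset (\<lambda>(z, v). (conc k l x z \<oplus>\<^bsub>P (k + l)\<^esub> conc k l x' z, v)) s"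
        by (rule image_mset_cong) (auto simp: IH(3) mem x x')
      with tensor_class_eqI'[OF tensor_eq_map_add[OF IH(1) IH(1) s(1)]] x x'
      show ?thesis
        unfolding conc_cls[OF x] conc_cls[OF x'] conc_cls[OF P.a_closed[OF x x']] add_Suc_right
          tensor_power_Suc_simps(3)[OF closed[OF x] closed[OF x']] by simp
    qed
    show "leq (P (k + Suc l)) (conc k (Suc l) x y) (conc k (Suc l) x' y)"
      if "leq (P k) x x'"
      unfolding conc_cls[OF x] conc_cls[OF x'] add_Suc_right
        tensor_power_Suc_simps(5)[OF closed[OF x] closed[OF x']]
      using IH(1,5) x x' that s(1) by (intro tensor_le_map_mono)
  qed
qed

lemma concat_closed: "x \<in> carrier (P k) \<Longrightarrow> y \<in> carrier (P l) \<Longrightarrow> conc k l x y \<in> carrier (P (k + l))"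
  by (rule monotone_linear.map_closed[OF monotone_linear_concat_right])

lemma concat_zero_left: "y \<in> carrier (P l) \<Longrightarrow> conc k l \<zero>\<^bsub>P k\<^esub> y = \<zero>\<^bsub>P (k + l)\<^esub>"
  by (rule monotone_linear.map_zero[OF monotone_linear_concat_left])

lemma concat_zero_right: "x \<in> carrier (P k) \<Longrightarrow> conc k l x \<zero>\<^bsub>P l\<^esub> = \<zero>\<^bsub>P (k + l)\<^esub>"
  by (rule monotone_linear.map_zero[OF monotone_linear_concat_right])

lemma leq_concat:
  assumes "x \<in> carrier (P k)" "x' \<in> carrier (P k)" "y \<in> carrier (P l)" "y' \<in> carrier (P l)"
    and "leq (P k) x x'" "leq (P l) y y'"
  shows "leq (P (k + l)) (conc k l x y) (conc k l x' y')"
proof (rule ordered_semimodule.leq_trans[OF ordered_semimodule_power])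
  show "leq (P (k + l)) (conc k l x y) (conc k l x' y)"
    using assms(1,2,5) by (rule monotone_linear.map_mono[OF monotone_linear_concat_left[OF assms(3)]])
  show "leq (P (k + l)) (conc k l x' y) (conc k l x' y')"
    using assms(3,4,6) by (rule monotone_linear.map_mono[OF monotone_linear_concat_right[OF assms(2)]])
qed (use assms in \<open>simp_all add: concat_closed\<close>)

lemma concat_scalar_left: "y \<in> carrier (P l) \<Longrightarrow> conc 0 l (Scal b) y = b \<odot>\<^bsub>P l\<^esub> y"
proof (induction l arbitrary: y)
  case 0
  then show ?case by (auto simp: mult.commute)
next
  case (Suc l)
  obtain s where s: "s \<in> sums l" "y = tensor_class Bp n l s"
    using Suc.prems unfolding tensor_power_Suc_simps by blast
  have "image_mset (\<lambda>(z, v). (conc 0 l (Scal b) z, v)) s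
      = image_mset (\<lambda>(z, v). (b \<odot>\<^bsub>P l\<^esub> z, v)) s"
    using s(1) Suc.IH by (intro image_mset_cong) auto
  then show ?case
    using concat_class[OF _ s(1), of "Scal b" 0] s
    by (simp add: tensor_power_Suc_simps(4))
qed

text \<open>The inverse of the canonical isomorphism $B \otimes B^n \to B^n$.\<close>

definition degree_one :: "(nat \<Rightarrow> 'a) \<Rightarrow> 'a tens" where
  "degree_one v = tensor_class Bp n 0 {#(Scal 1, v)#}"

lemma degree_one_sums: "v \<in> carrier F \<Longrightarrow> {#(Scal b, v)#} \<in> sums 0"
  by simp

lemma monotone_linear_degree_one: "monotone_linear F (P 1) degree_one"
proof -
  interpret tensor_factors "P 0" F by (rule tensor_factors_power)
  have one: "Scal 1 \<in> carrier (P 0)" by simp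
  note mem = degree_one_sums[of _ 1]
  show ?thesis
  proof
    show "degree_one \<zero>\<^bsub>F\<^esub> = \<zero>\<^bsub>P 1\<^esub>"
      unfolding One_nat_def tensor_power_Suc_simps degree_one_def
      by (intro tensor_class_eqI' tensor_eq.zero_right one)
    fix v assume v: "v \<in> carrier F"
    show "degree_one v \<in> carrier (P 1)"
      unfolding One_nat_def tensor_power_Suc_simps degree_one_def using mem[OF v] by (rule imageI)
    show "degree_one (b \<odot>\<^bsub>F\<^esub> v) = b \<odot>\<^bsub>P 1\<^esub> degree_one v" for b
      unfolding One_nat_def degree_one_def tensor_power_Suc_simps(4)[OF mem[OF v]]
      using tensor_eq.smult[OF one v, of b]
      by (intro tensor_class_eqI') (auto simp del: free_module_simps intro: tensor_eq.sym)
    fix w assume w: "w \<in> carrier F"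
    show "degree_one (v \<oplus>\<^bsub>F\<^esub> w) = degree_one v \<oplus>\<^bsub>P 1\<^esub> degree_one w"
      unfolding One_nat_def degree_one_def tensor_power_Suc_simps(3)[OF mem[OF v] mem[OF w]]
      using tensor_eq.add_right[OF one v w] by (intro tensor_class_eqI') (simp add: add_mset_commute)
    show "leq (P 1) (degree_one v) (degree_one w)" if "leq F v w"
      unfolding One_nat_def degree_one_def tensor_power_Suc_simps(5)[OF mem[OF v] mem[OF w]]
      using that by (intro tensor_le.tensor one v w) simp_all
  qed
qed

lemma degree_one_surj: "degree_one ` carrier F = carrier (P 1)"
proof -
  interpret tensor_factors "P 0" F by (rule tensor_factors_power)
  interpret d: monotone_linear F "P 1" degree_one by (rule monotone_linear_degree_one)
  have "tensor_class Bp n 0 s \<in> degree_one ` carrier F" if "s \<in> sums 0" for s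
    using that
  proof (induction s)
    case empty
    have "tensor_class Bp n 0 {#} = degree_one \<zero>\<^bsub>F\<^esub>"
      unfolding d.map_zero One_nat_def tensor_power_Suc_simps ..
    then show ?case using N.zero_closed by (rule image_eqI)
  next
    case (add p s)
    obtain z v where p: "p = (z, v)" by (cases p)
    note split = formal_sum_split[OF add.prems[unfolded p]]
    obtain b where z: "z = Scal b" using split(1) by auto
    obtain w where w: "w \<in> carrier F" "tensor_class Bp n 0 s = degree_one w"
      using add.IH[OF split(3)] by blast
    have "tensor_class Bp n 0 {#p#} = b \<odot>\<^bsub>P 1\<^esub> degree_one v"
      unfolding One_nat_def degree_one_def tensor_power_Suc_simps(4)[OF degree_one_sums[OF split(2)]]
      by (simp add: p z)
    also have "\<dots> = degree_one (b \<odot>\<^bsub>F\<^esub> v)" using d.map_smult[OF split(2)] ..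
    finally have "tensor_class Bp n 0 (add_mset p s) = degree_one (b \<odot>\<^bsub>F\<^esub> v \<oplus>\<^bsub>F\<^esub> w)"
      unfolding d.map_add[OF N.smult_closed[OF split(2)] w(1)] w(2)[symmetric]
      using tensor_power_Suc_simps(3)[OF degree_one_sums[OF split(2)] split(3), of b] p z
      by simp
    then show ?case
      using N.a_closed[OF N.smult_closed[OF split(2)] w(1)] by (rule image_eqI)
  qed
  then show ?thesis
    using d.map_closed unfolding One_nat_def tensor_power_Suc_simps(1) by blast
qed

text \<open>
  That $v \mapsto 1 \otimes v$ reflects the order is seen by applying the evaluation
  $\sum_j b_j \otimes v_j \mapsto \sum_j b_j v_j$, which is monotone. First factors of degree zero
  have the form \<^term>\<open>Scal b\<close>, so the value in the other case is arbitrary.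
\<close>

definition evaluate :: "('a tens \<times> (nat \<Rightarrow> 'a)) multiset \<Rightarrow> nat \<Rightarrow> 'a" where
  "evaluate s i = (\<Sum>(z, v)\<in>#s. (case z of Scal b \<Rightarrow> b * v i | Tens _ \<Rightarrow> 0))"

lemma evaluate_simps:
  "evaluate {#} i = 0"
  "evaluate (add_mset (Scal b, v) s) i = b * v i + evaluate s i"
  "evaluate (s + t) i = evaluate s i + evaluate t i"
  by (simp_all add: evaluate_def)

lemma evaluate_smult:
  assumes "s \<in> sums 0"
  shows "evaluate (b \<odot>\<^bsub>formal_sums (P 0) F\<^esub> s) i = b * evaluate s i"
  using assms
  by (induction s)
     (auto simp: evaluate_simps distrib_left mult.assoc)

lemma evaluate_tensor_eq: "tensor_eq (P 0) F s t \<Longrightarrow> evaluate s i = evaluate t i"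
  by (induction rule: tensor_eq.induct)
     (auto simp: evaluate_simps distrib_left distrib_right ac_simps)

lemma evaluate_tensor_le:
  assumes "tensor_le (P 0) F s t" "i \<in> {1..n}"
  shows "evaluate s i \<le> evaluate t i"
proof -
  interpret tensor_factors "P 0" F by (rule tensor_factors_power)
  from assms(1) show ?thesis
  proof induction
    case (eq s t)
    then show ?case by (simp add: evaluate_tensor_eq)
  next
    case (trans s t u)
    show ?case by (rule order_trans[OF trans.IH])
  next
    case (add s t u)
    then show ?case by (simp add: evaluate_simps add_right_mono)
  next
    case (smult b c s t)
    with tensor_le_carrier[OF smult.hyps(2)] show ?case
      by (simp only: evaluate_smult mult_mono_all)
  next
    case (tensor x x' y y')
    then show ?case
      using assms(2) by (auto simp: evaluate_simps mult_mono_all)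
  qed
qed

lemma degree_one_reflects:
  assumes "v \<in> carrier F" "w \<in> carrier F" "leq (P 1) (degree_one v) (degree_one w)"
  shows "leq F v w"
proof -
  have "tensor_le (P 0) F {#(Scal 1, v)#} {#(Scal 1, w)#}"
    using assms(3)
    unfolding One_nat_def degree_one_def
      tensor_power_Suc_simps(5)[OF degree_one_sums[OF assms(1)] degree_one_sums[OF assms(2)]] .
  from evaluate_tensor_le[OF this] show ?thesis by (simp add: evaluate_simps)
qed


section \<open>The tensor algebra\<close>

abbreviation T :: "('a, nat \<Rightarrow> 'a tens) blue_struct" where
  "T \<equiv> tensor_algebra Bp n"

abbreviation incl :: "nat \<Rightarrow> 'a tens \<Rightarrow> nat \<Rightarrow> 'a tens" where
  "incl \<equiv> tensor_incl Bp n"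

lemma tensor_algebra_simps:
  "\<zero>\<^bsub>T\<^esub> = (\<lambda>l. \<zero>\<^bsub>P l\<^esub>)"
  "\<one>\<^bsub>T\<^esub> = incl 0 (Scal 1)"
  "f \<oplus>\<^bsub>T\<^esub> g = (\<lambda>l. f l \<oplus>\<^bsub>P l\<^esub> g l)"
  "b \<odot>\<^bsub>T\<^esub> f = (\<lambda>l. b \<odot>\<^bsub>P l\<^esub> f l)"
  "leq T f g \<longleftrightarrow> (\<forall>l. leq (P l) (f l) (g l))"
  "(f \<otimes>\<^bsub>T\<^esub> g) m = finsum (P m) (\<lambda>k. conc k (m - k) (f k) (g (m - k))) {..m}"
  by (simp_all add: tensor_algebra_def Let_def)

lemma carrier_tensor_algebra:
  "f \<in> carrier T \<longleftrightarrow> (\<forall>l. f l \<in> carrier (P l)) \<and> (\<exists>N. \<forall>l\<ge>N. f l = \<zero>\<^bsub>P l\<^esub>)"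
proof -
  have "finite {l. f l \<noteq> \<zero>\<^bsub>P l\<^esub>} \<longleftrightarrow> (\<exists>N. \<forall>l\<ge>N. f l = \<zero>\<^bsub>P l\<^esub>)"
    unfolding finite_nat_set_iff_bounded by (metis (mono_tags, lifting) mem_Collect_eq not_le)
  then show ?thesis by (simp add: tensor_algebra_def Let_def)
qed

lemma carrier_component: "f \<in> carrier T \<Longrightarrow> f l \<in> carrier (P l)"
  by (simp add: carrier_tensor_algebra)

lemma carrierI_bounded:
  assumes "\<And>l. f l \<in> carrier (P l)" "\<And>l. l \<ge> N \<Longrightarrow> f l = \<zero>\<^bsub>P l\<^esub>"
  shows "f \<in> carrier T"
  unfolding carrier_tensor_algebra using assms by blast

lemma carrier_bounded2:
  assumes "f \<in> carrier T" "g \<in> carrier T"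
  obtains N where "\<And>l. l \<ge> N \<Longrightarrow> f l = \<zero>\<^bsub>P l\<^esub>" "\<And>l. l \<ge> N \<Longrightarrow> g l = \<zero>\<^bsub>P l\<^esub>"
proof -
  obtain N1 where N1: "\<forall>l\<ge>N1. f l = \<zero>\<^bsub>P l\<^esub>" using assms(1) unfolding carrier_tensor_algebra by blast
  obtain N2 where N2: "\<forall>l\<ge>N2. g l = \<zero>\<^bsub>P l\<^esub>" using assms(2) unfolding carrier_tensor_algebra by blast
  show ?thesis by (rule that[of "max N1 N2"]) (use N1 N2 in simp_all)
qed

lemma tensor_algebra_add_closed:
  assumes "f \<in> carrier T" "g \<in> carrier T"
  shows "f \<oplus>\<^bsub>T\<^esub> g \<in> carrier T"
proof -
  obtain N where "\<And>l. l \<ge> N \<Longrightarrow> f l = \<zero>\<^bsub>P l\<^esub>" "\<And>l. l \<ge> N \<Longrightarrow> g l = \<zero>\<^bsub>P l\<^esub>"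
    using carrier_bounded2[OF assms] by blast
  then show ?thesis
    by (intro carrierI_bounded[where N = N])
       (simp_all add: tensor_algebra_simps carrier_component assms)
qed

lemma tensor_algebra_smult_closed:
  assumes "f \<in> carrier T"
  shows "b \<odot>\<^bsub>T\<^esub> f \<in> carrier T"
proof -
  obtain N where "\<And>l. l \<ge> N \<Longrightarrow> f l = \<zero>\<^bsub>P l\<^esub>"
    using carrier_bounded2[OF assms assms] by blast
  then show ?thesis
    by (intro carrierI_bounded[where N = N])
       (simp_all add: tensor_algebra_simps carrier_component assms P.smult_zero P.smult_closed)
qed

lemma ordered_semimodule_tensor_algebra: "ordered_semimodule T"
proof (intro ordered_semimodule.intro)
  have zero: "\<zero>\<^bsub>T\<^esub> \<in> carrier T"
    by (intro carrierI_bounded[where N = 0]) (simp_all add: tensor_algebra_simps)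
  show "abelian_monoid T"
    by (rule abelian_monoidI)
       (simp_all add: tensor_algebra_add_closed zero,
        simp_all add: tensor_algebra_simps carrier_component P.a_ac)
  show "ordered_semimodule_axioms T"
  proof (unfold_locales, goal_cases)
    \<comment> \<open>antisymmetry of the order\<close>
    case (9 f g)
    show ?case
    proof
      fix l show "f l = g l"
        using 9(3,4) unfolding tensor_algebra_simps
        by (intro P.leq_antisym[of "f l" l "g l"] carrier_component[OF 9(1)]
            carrier_component[OF 9(2)]) blast+
    qed
  next
    \<comment> \<open>transitivity of the order\<close>
    case (10 f g h)
    show ?case
      unfolding tensor_algebra_simps
    proof
      fix l show "leq (P l) (f l) (h l)"
        using 10(4,5) P.leq_trans[of "f l" l "g l" "h l"]
        by (simp add: tensor_algebra_simps carrier_component 10(1-3))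
    qed
  qed (simp_all add: tensor_algebra_smult_closed,
       simp_all add: tensor_algebra_simps carrier_component P.smult_add_left P.smult_add_right
         P.smult_smult P.one_smult P.zero_smult P.smult_zero P.leq_refl P.leq_add P.leq_smult)
qed

sublocale T: ordered_semimodule T
  by (rule ordered_semimodule_tensor_algebra)

lemma concat_complement_closed:
  assumes "f k \<in> carrier (P k)" "g (m - k) \<in> carrier (P (m - k))" "k \<le> m"
  shows "conc k (m - k) (f k) (g (m - k)) \<in> carrier (P m)"
  using concat_closed[OF assms(1,2)] assms(3) by simp

lemma tensor_algebra_mult_closed:
  assumes "f \<in> carrier T" "g \<in> carrier T"
  shows "f \<otimes>\<^bsub>T\<^esub> g \<in> carrier T"
proof -
  obtain N where N: "\<And>l. l \<ge> N \<Longrightarrow> f l = \<zero>\<^bsub>P l\<^esub>" "\<And>l. l \<ge> N \<Longrightarrow> g l = \<zero>\<^bsub>P l\<^esub>"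
    using carrier_bounded2[OF assms] by blast
  note component = carrier_component[OF assms(1)] carrier_component[OF assms(2)]
  show ?thesis
  proof (rule carrierI_bounded[where N = "N + N"])
    show "(f \<otimes>\<^bsub>T\<^esub> g) m \<in> carrier (P m)" for m
      unfolding tensor_algebra_simps
      by (intro P.finsum_closed) (auto intro: concat_complement_closed component)
    fix m assume m: "m \<ge> N + N"
    have "conc k (m - k) (f k) (g (m - k)) = \<zero>\<^bsub>P m\<^esub>" if k: "k \<le> m" for k
    proof (cases "k \<ge> N")
      case True
      then show ?thesis
        using concat_zero_left[of "g (m - k)" "m - k" k] component k by (simp add: N)
    next
      case False
      then have "g (m - k) = \<zero>\<^bsub>P (m - k)\<^esub>" using m by (intro N) simp
      then show ?thesis
        using concat_zero_right[of "f k" k "m - k"] component k by simp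
    qed
    then have "(f \<otimes>\<^bsub>T\<^esub> g) m = finsum (P m) (\<lambda>_. \<zero>\<^bsub>P m\<^esub>) {..m}"
      unfolding tensor_algebra_simps by (intro P.finsum_cong') auto
    then show "(f \<otimes>\<^bsub>T\<^esub> g) m = \<zero>\<^bsub>P m\<^esub>" by simp
  qed
qed

text \<open>
  The component of degree $m$ of a product depends only on the components of degree at most $m$ of
  the factors, and concatenation is monotone. The bound on the degree is what makes the degree zero
  and one parts of the exterior algebra accessible.
\<close>

lemma tensor_algebra_mult_mono:
  assumes "f \<in> carrier T" "f' \<in> carrier T" "g \<in> carrier T" "g' \<in> carrier T"
    and "\<And>k. k \<le> m \<Longrightarrow> leq (P k) (f k) (f' k)" "\<And>k. k \<le> m \<Longrightarrow> leq (P k) (g k) (g' k)"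
  shows "leq (P m) ((f \<otimes>\<^bsub>T\<^esub> g) m) ((f' \<otimes>\<^bsub>T\<^esub> g') m)"
  unfolding tensor_algebra_simps
proof (rule P.leq_finsum)
  fix k assume "k \<in> {..m}"
  then show "leq (P m) (conc k (m - k) (f k) (g (m - k))) (conc k (m - k) (f' k) (g' (m - k)))"
    using leq_concat[of "f k" k "f' k" "g (m - k)" "m - k" "g' (m - k)"] assms
    by (simp add: carrier_component)
qed (use assms in \<open>auto intro: concat_complement_closed carrier_component\<close>)

lemma monotone_linear_incl: "monotone_linear (P l) T (incl l)"
proof
  fix x y b assume x: "x \<in> carrier (P l)"
  show "incl l x \<in> carrier T"
    by (rule carrierI_bounded[where N = "Suc l"]) (auto simp: tensor_incl_def x)
  show "incl l (b \<odot>\<^bsub>P l\<^esub> x) = b \<odot>\<^bsub>T\<^esub> incl l x"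
    by (auto simp: tensor_algebra_simps tensor_incl_def fun_eq_iff P.smult_zero)
  assume "y \<in> carrier (P l)"
  show "incl l (x \<oplus>\<^bsub>P l\<^esub> y) = incl l x \<oplus>\<^bsub>T\<^esub> incl l y"
    by (auto simp: tensor_algebra_simps tensor_incl_def fun_eq_iff)
  show "leq T (incl l x) (incl l y)" if "leq (P l) x y"
    using that by (auto simp: tensor_algebra_simps tensor_incl_def P.leq_refl)
qed (auto simp: tensor_algebra_simps tensor_incl_def fun_eq_iff)

lemmas incl_closed = monotone_linear.map_closed[OF monotone_linear_incl]

lemma incl_mult:
  assumes x: "x \<in> carrier (P k)" and f: "f \<in> carrier T"
  shows "(incl k x \<otimes>\<^bsub>T\<^esub> f) m = (if k \<le> m then conc k (m - k) x (f (m - k)) else \<zero>\<^bsub>P m\<^esub>)"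
proof -
  have summand: "conc j (m - j) (incl k x j) (f (m - j))
      = (if k = j then conc j (m - j) x (f (m - j)) else \<zero>\<^bsub>P m\<^esub>)" if "j \<le> m" for j
    using concat_zero_left[OF carrier_component[OF f], of j "m - j"] that
    by (simp add: tensor_incl_def)
  show ?thesis
  proof (cases "k \<le> m")
    case True
    have "(incl k x \<otimes>\<^bsub>T\<^esub> f) m
        = finsum (P m) (\<lambda>j. if k = j then conc k (m - k) x (f (m - k)) else \<zero>\<^bsub>P m\<^esub>) {..m}"
      unfolding tensor_algebra_simps
      using concat_closed[OF x carrier_component[OF f], of "m - k"] True
      by (intro P.finsum_cong') (auto simp: summand)
    also have "\<dots> = conc k (m - k) x (f (m - k))"
      using concat_closed[OF x carrier_component[OF f], of "m - k"] True
      by (intro P.finsum_singleton) auto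
    finally show ?thesis using True by simp
  next
    case False
    then have "(incl k x \<otimes>\<^bsub>T\<^esub> f) m = finsum (P m) (\<lambda>j. \<zero>\<^bsub>P m\<^esub>) {..m}"
      unfolding tensor_algebra_simps by (intro P.finsum_cong') (auto simp: summand)
    then show ?thesis using False by simp
  qed
qed

lemma incl_mult_incl:
  assumes "x \<in> carrier (P k)" "y \<in> carrier (P l)"
  shows "incl k x \<otimes>\<^bsub>T\<^esub> incl l y = incl (k + l) (conc k l x y)"
proof
  fix m
  have "conc k (m - k) x \<zero>\<^bsub>P (m - k)\<^esub> = \<zero>\<^bsub>P m\<^esub>" if "k \<le> m"
    using concat_zero_right[OF assms(1), of "m - k"] that by simp
  then show "(incl k x \<otimes>\<^bsub>T\<^esub> incl l y) m = incl (k + l) (conc k l x y) m"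
    unfolding incl_mult[OF assms(1) incl_closed[OF assms(2)]] by (auto simp: tensor_incl_def)
qed

lemma scalar_mult:
  assumes "f \<in> carrier T"
  shows "incl 0 (Scal b) \<otimes>\<^bsub>T\<^esub> f = b \<odot>\<^bsub>T\<^esub> f"
proof
  fix m show "(incl 0 (Scal b) \<otimes>\<^bsub>T\<^esub> f) m = (b \<odot>\<^bsub>T\<^esub> f) m"
    using incl_mult[of "Scal b" 0 f m] assms
    by (simp add: tensor_algebra_simps concat_scalar_left carrier_component)
qed

lemma incl_mult_one:
  assumes "x \<in> carrier (P l)"
  shows "incl l x \<otimes>\<^bsub>T\<^esub> \<one>\<^bsub>T\<^esub> = incl l x"
  using incl_mult_incl[OF assms, of "Scal 1" 0] assms
  by (simp add: tensor_algebra_simps P.one_smult)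

text \<open>
  As $z \otimes v$ is the product of $z$ and $1 \otimes v$, every degree is generated by the previous
  one and degree one.
\<close>

lemma incl_generated: "x \<in> carrier (P l) \<Longrightarrow> incl l x \<in> subalgebra_span T (incl 1 ` carrier (P 1))"
proof (induction l arbitrary: x)
  case 0
  then obtain b where "x = Scal b" by auto
  then have "incl 0 x = b \<odot>\<^bsub>T\<^esub> \<one>\<^bsub>T\<^esub>"
    using monotone_linear.map_smult[OF monotone_linear_incl, of "Scal 1" 0 b]
    by (simp add: tensor_algebra_simps(2))
  then show ?case by (simp add: subalgebra_span.smult subalgebra_span.one)
next
  case (Suc l)
  interpret tensor_factors "P l" F by (rule tensor_factors_power)
  interpret i: monotone_linear "P (Suc l)" T "incl (Suc l)" by (rule monotone_linear_incl)
  have class_closed: "tensor_class Bp n l s \<in> carrier (P (Suc l))" if "s \<in> sums l" for s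
    unfolding tensor_power_Suc_simps(1) using that by (rule imageI)
  have "incl (Suc l) (tensor_class Bp n l s) \<in> subalgebra_span T (incl 1 ` carrier (P 1))"
    if "s \<in> sums l" for s
    using that
  proof (induction s)
    case empty
    show ?case
      unfolding tensor_power_Suc_simps(2)[symmetric] i.map_zero by (rule subalgebra_span.zero)
  next
    case (add p s)
    obtain z v where p: "p = (z, v)" by (cases p)
    note split = formal_sum_split[OF add.prems[unfolded p]]
    have zv: "{#(z, v)#} \<in> sums l" using split by simp
    have v: "degree_one v \<in> carrier (P 1)"
      by (rule monotone_linear.map_closed[OF monotone_linear_degree_one split(2)])
    have "conc l 1 z (degree_one v) = tensor_class Bp n l {#(z, v)#}"
      using concat_class[OF split(1) degree_one_sums[OF split(2)], of 1] split(1)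
      by (simp add: degree_one_def P.one_smult)
    then have "incl (Suc l) (tensor_class Bp n l {#(z, v)#}) = incl l z \<otimes>\<^bsub>T\<^esub> incl 1 (degree_one v)"
      using incl_mult_incl[OF split(1) v] by simp
    then have "incl (Suc l) (tensor_class Bp n l {#(z, v)#})
        \<in> subalgebra_span T (incl 1 ` carrier (P 1))"
      using Suc.IH[OF split(1)] v by (auto intro: subalgebra_span.intros)
    moreover have "incl (Suc l) (tensor_class Bp n l (add_mset p s))
        = incl (Suc l) (tensor_class Bp n l {#(z, v)#}) \<oplus>\<^bsub>T\<^esub> incl (Suc l) (tensor_class Bp n l s)"
      using i.map_add[OF class_closed[OF zv] class_closed[OF split(3)]]
      unfolding tensor_power_Suc_simps(3)[OF zv split(3)] p by simp
    ultimately show ?case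
      using add.IH[OF split(3)] by (simp add: subalgebra_span.add)
  qed
  then show ?case using Suc.prems unfolding tensor_power_Suc_simps(1) by blast
qed

lemma tensor_algebra_span_closed:
  assumes "f \<in> subalgebra_span T (incl 1 ` carrier (P 1))"
  shows "f \<in> carrier T"
  using assms
proof induction
  case one
  then show ?case by (simp add: tensor_algebra_simps(2) incl_closed)
qed (auto simp: incl_closed T.smult_closed tensor_algebra_mult_closed)

lemma tensor_algebra_generated: "carrier T = subalgebra_span T (incl 1 ` carrier (P 1))"
proof (intro equalityI subsetI)
  fix f assume f: "f \<in> carrier T"
  have "\<forall>l. f l \<in> carrier (P l) \<Longrightarrow> \<forall>l\<ge>N. f l = \<zero>\<^bsub>P l\<^esub> \<Longrightarrow>
      f \<in> subalgebra_span T (incl 1 ` carrier (P 1))" for N f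
  proof (induction N arbitrary: f)
    case 0
    then have "f = \<zero>\<^bsub>T\<^esub>" by (simp add: tensor_algebra_simps fun_eq_iff)
    then show ?case by (simp add: subalgebra_span.zero)
  next
    case (Suc N)
    have "f(N := \<zero>\<^bsub>P N\<^esub>) \<in> subalgebra_span T (incl 1 ` carrier (P 1))"
      using Suc.prems by (intro Suc.IH) (auto simp: Suc_le_eq)
    moreover have "f = f(N := \<zero>\<^bsub>P N\<^esub>) \<oplus>\<^bsub>T\<^esub> incl N (f N)"
      using Suc.prems by (auto simp: tensor_algebra_simps tensor_incl_def fun_eq_iff)
    ultimately show ?case
      using incl_generated[of "f N" N] Suc.prems(1) by (metis subalgebra_span.add)
  qed
  then show "f \<in> subalgebra_span T (incl 1 ` carrier (P 1))"
    using f unfolding carrier_tensor_algebra by blast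
qed (rule tensor_algebra_span_closed)

end


section \<open>The exterior algebra\<close>

locale exterior = tensor_powers Bp n
  for Bp :: "'a::ord_comm_semiring set" and n :: nat +
  fixes eps :: 'a
begin

abbreviation le :: "(nat \<Rightarrow> 'a tens) \<Rightarrow> (nat \<Rightarrow> 'a tens) \<Rightarrow> bool" where
  "le \<equiv> exterior_le Bp eps n"

abbreviation A :: "('a, (nat \<Rightarrow> 'a tens) set) blue_struct" where
  "A \<equiv> exterior_ambient Bp eps n"

lemma basis_vec_carrier: "i \<in> {1..n} \<Longrightarrow> basis_vec i \<in> carrier F"
  by (auto simp: basis_vec_def)

lemma degree_one_basis_carrier: "i \<in> {1..n} \<Longrightarrow> degree_one (basis_vec i) \<in> carrier (P 1)"
  using monotone_linear.map_closed[OF monotone_linear_degree_one] basis_vec_carrier by blast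

lemma tensor_gen_eq: "tensor_gen Bp n i = incl 1 (degree_one (basis_vec i))"
  by (simp add: tensor_gen_def degree_one_def)

text \<open>A product of two generators $1 \otimes e_i$, $1 \otimes e_j$ lies in degree two.\<close>

lemma exterior_rel_degree_two:
  assumes "(x, y) \<in> exterior_rel Bp eps n"
  shows "\<exists>u\<in>carrier (P 2). \<exists>v\<in>carrier (P 2). x = incl 2 u \<and> y = incl 2 v"
proof -
  interpret i: monotone_linear "P 2" T "incl 2" by (rule monotone_linear_incl)
  have gen_mult: "\<exists>u\<in>carrier (P 2). tensor_gen Bp n i \<otimes>\<^bsub>T\<^esub> tensor_gen Bp n j = incl 2 u"
    if "i \<in> {1..n}" "j \<in> {1..n}" for i j
  proof
    note carrier = degree_one_basis_carrier[OF that(1)] degree_one_basis_carrier[OF that(2)]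
    let ?u = "conc 1 1 (degree_one (basis_vec i)) (degree_one (basis_vec j))"
    have two: "1 + 1 = (2::nat)" by simp
    show "?u \<in> carrier (P 2)" using concat_closed[OF carrier] unfolding two .
    show "tensor_gen Bp n i \<otimes>\<^bsub>T\<^esub> tensor_gen Bp n j = incl 2 ?u"
      using incl_mult_incl[OF carrier] unfolding two tensor_gen_eq .
  qed
  consider (square) i where "i \<in> {1..n}" "x = tensor_gen Bp n i \<otimes>\<^bsub>T\<^esub> tensor_gen Bp n i" "y = \<zero>\<^bsub>T\<^esub>"
    | (swap) i j where "i \<in> {1..n}" "j \<in> {1..n}" "x = tensor_gen Bp n i \<otimes>\<^bsub>T\<^esub> tensor_gen Bp n j"
        "y = eps \<odot>\<^bsub>T\<^esub> (tensor_gen Bp n j \<otimes>\<^bsub>T\<^esub> tensor_gen Bp n i)"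
    using assms unfolding exterior_rel_def Let_def by blast
  then show ?thesis
  proof cases
    case square
    obtain u where "u \<in> carrier (P 2)" "x = incl 2 u"
      using gen_mult[OF square(1) square(1)] square(2) by auto
    moreover have "y = incl 2 \<zero>\<^bsub>P 2\<^esub>" using square(3) i.map_zero by simp
    ultimately show ?thesis using P.zero_closed by blast
  next
    case swap
    obtain u where u: "u \<in> carrier (P 2)" "x = incl 2 u"
      using gen_mult[OF swap(1) swap(2)] swap(3) by auto
    obtain v where v: "v \<in> carrier (P 2)" "tensor_gen Bp n j \<otimes>\<^bsub>T\<^esub> tensor_gen Bp n i = incl 2 v"
      using gen_mult[OF swap(2) swap(1)] by auto
    have "y = incl 2 (eps \<odot>\<^bsub>P 2\<^esub> v)" using swap(4) v i.map_smult[OF v(1)] by simp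
    with u P.smult_closed[OF v(1)] show ?thesis by blast
  qed
qed

lemma exterior_rel_carrier:
  "(x, y) \<in> exterior_rel Bp eps n \<Longrightarrow> x \<in> carrier T \<and> y \<in> carrier T"
  using exterior_rel_degree_two incl_closed by blast

lemma exterior_le_carrier:
  assumes "le x y"
  shows "x \<in> carrier T \<and> y \<in> carrier T"
  using assms unfolding exterior_le_def
  by induction (use exterior_rel_carrier in \<open>auto simp: tensor_algebra_mult_closed\<close>)

text \<open>
  Multiplication does not lower degrees, so relations of degree two have no effect on components of
  degree zero and one: there the preorder is the order of $T(B^n)$.
\<close>

lemma exterior_le_low_degree:
  assumes "le x y" "l < 2"
  shows "leq (P l) (x l) (y l)"
proof -
  have vanish: "x l = \<zero>\<^bsub>P l\<^esub> \<and> y l = \<zero>\<^bsub>P l\<^esub>" if "(x, y) \<in> exterior_rel Bp eps n" "l < 2" for x y l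
    using exterior_rel_degree_two[OF that(1)] that(2) by (auto simp: tensor_incl_def)
  from assms show ?thesis
    unfolding exterior_le_def
  proof (induction arbitrary: l)
    case (base x y)
    then show ?case by (simp add: tensor_algebra_simps)
  next
    case (rel x y)
    then show ?case using vanish[of x y l] by (simp add: P.leq_refl)
  next
    case (rel_sym x y)
    then show ?case using vanish[of x y l] by (simp add: P.leq_refl)
  next
    case (trans x y z)
    then have "x \<in> carrier T" "y \<in> carrier T" "z \<in> carrier T"
      using exterior_le_carrier unfolding exterior_le_def by blast+
    then show ?case
      using trans.IH[OF trans.prems] P.leq_trans carrier_component by blast
  next
    case (add x y z)
    then have "x \<in> carrier T" "y \<in> carrier T"
      using exterior_le_carrier unfolding exterior_le_def by blast+
    then show ?case
      using add by (simp add: tensor_algebra_simps P.leq_add carrier_component)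
  next
    case (mult_left x y z)
    then have "x \<in> carrier T" "y \<in> carrier T"
      using exterior_le_carrier unfolding exterior_le_def by blast+
    then show ?case
      using mult_left by (intro tensor_algebra_mult_mono) (simp_all add: P.leq_refl carrier_component)
  next
    case (mult_right x y z)
    then have "x \<in> carrier T" "y \<in> carrier T"
      using exterior_le_carrier unfolding exterior_le_def by blast+
    then show ?case
      using mult_right by (intro tensor_algebra_mult_mono) (simp_all add: P.leq_refl carrier_component)
  qed
qed

lemma leq_imp_le: "x \<in> carrier T \<Longrightarrow> y \<in> carrier T \<Longrightarrow> leq T x y \<Longrightarrow> le x y"
  unfolding exterior_le_def by (rule algebra_preorder.base)

lemma le_refl: "x \<in> carrier T \<Longrightarrow> le x x"
  by (simp add: leq_imp_le T.leq_refl)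

lemma le_trans: "le x y \<Longrightarrow> le y z \<Longrightarrow> le x z"
  unfolding exterior_le_def by (rule algebra_preorder.trans)

lemma le_equal: "x \<in> carrier T \<Longrightarrow> x = y \<Longrightarrow> (x, y) \<in> preorder_equiv T le"
  by (simp add: preorder_equiv_def le_refl)

lemma le_smult:
  assumes "b \<le> c" "le x y"
  shows "le (b \<odot>\<^bsub>T\<^esub> x) (c \<odot>\<^bsub>T\<^esub> y)"
proof -
  have carrier: "x \<in> carrier T" "y \<in> carrier T" using exterior_le_carrier[OF assms(2)] by simp_all
  have "le (incl 0 (Scal b) \<otimes>\<^bsub>T\<^esub> x) (incl 0 (Scal b) \<otimes>\<^bsub>T\<^esub> y)"
    using assms(2) unfolding exterior_le_def
    by (rule algebra_preorder.mult_left) (simp add: incl_closed)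
  then have "le (b \<odot>\<^bsub>T\<^esub> x) (b \<odot>\<^bsub>T\<^esub> y)" by (simp add: scalar_mult carrier)
  moreover have "le (b \<odot>\<^bsub>T\<^esub> y) (c \<odot>\<^bsub>T\<^esub> y)"
    using carrier assms(1) by (intro leq_imp_le T.smult_closed T.leq_smult T.leq_refl)
  ultimately show ?thesis by (rule le_trans)
qed

sublocale Q: preordered_semimodule T le
proof (intro preordered_semimodule.intro preordered_semimodule_axioms.intro)
  show "abelian_monoid T" by (rule T.abelian_monoid_axioms)
  show "le (x \<oplus>\<^bsub>T\<^esub> z) (y \<oplus>\<^bsub>T\<^esub> z)" if "le x y" "z \<in> carrier T" for x y z
    using that unfolding exterior_le_def by (rule algebra_preorder.add)
  show "le x z" if "le x y" "le y z" for x y z using that by (rule le_trans)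
qed (simp_all add: exterior_le_carrier le_refl le_smult T.smult_closed le_equal T.smult_add_left
      T.smult_add_right T.smult_smult T.one_smult T.zero_smult T.smult_zero)

lemmas ambient_simps = Q.quot_simps[folded exterior_ambient_def]

sublocale A: ordered_semimodule A
  using Q.ordered_semimodule_quot by (simp add: exterior_ambient_def)

lemma ambient_mult:
  assumes "x \<in> carrier T" "y \<in> carrier T"
  shows "Q.cls x \<otimes>\<^bsub>A\<^esub> Q.cls y = Q.cls (x \<otimes>\<^bsub>T\<^esub> y)"
  unfolding exterior_ambient_def
  using assms tensor_algebra_mult_closed
proof (rule Q.mult_quot)
  show "le (z \<otimes>\<^bsub>T\<^esub> x) (z \<otimes>\<^bsub>T\<^esub> y)" if "le x y" "z \<in> carrier T" for x y z
    using that unfolding exterior_le_def by (rule algebra_preorder.mult_left)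
  show "le (x \<otimes>\<^bsub>T\<^esub> z) (y \<otimes>\<^bsub>T\<^esub> z)" if "le x y" "z \<in> carrier T" for x y z
    using that unfolding exterior_le_def by (rule algebra_preorder.mult_right)
qed

lemma ambient_one: "\<one>\<^bsub>A\<^esub> = Q.cls \<one>\<^bsub>T\<^esub>"
  by (simp add: exterior_ambient_def preorder_quot_def Let_def)

lemma monotone_linear_cls: "monotone_linear T A Q.cls"
  by unfold_locales (simp_all add: ambient_simps leq_imp_le)

definition homogeneous :: "nat \<Rightarrow> 'a tens \<Rightarrow> (nat \<Rightarrow> 'a tens) set" where
  "homogeneous l x = Q.cls (incl l x)"

lemma monotone_linear_homogeneous: "monotone_linear (P l) A (homogeneous l)"
  unfolding homogeneous_def by (rule monotone_linear_comp[OF monotone_linear_incl monotone_linear_cls])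

lemma homogeneous_reflects:
  assumes "l < 2" "x \<in> carrier (P l)" "y \<in> carrier (P l)"
    and "leq A (homogeneous l x) (homogeneous l y)"
  shows "leq (P l) x y"
proof -
  have "le (incl l x) (incl l y)"
    using assms(4) unfolding homogeneous_def by (simp add: ambient_simps incl_closed assms)
  from exterior_le_low_degree[OF this assms(1)] show ?thesis by (simp add: tensor_incl_def)
qed

text \<open>
  The embeddings of $B$ and $B^n$ into $A_n$ whose images are $\bigwedge^0 B^n$ and
  $\bigwedge^1 B^n$.
\<close>

definition scalar_class :: "'a \<Rightarrow> (nat \<Rightarrow> 'a tens) set" where
  "scalar_class b = homogeneous 0 (Scal b)"

definition vector_class :: "(nat \<Rightarrow> 'a) \<Rightarrow> (nat \<Rightarrow> 'a tens) set" where
  "vector_class v = homogeneous 1 (degree_one v)"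

lemma monotone_linear_scalar_class: "monotone_linear (base_module Bp) A scalar_class"
proof -
  have "monotone_linear (base_module Bp) (P 0) Scal"
    by unfold_locales simp_all
  then show ?thesis
    unfolding scalar_class_def by (rule monotone_linear_comp[OF _ monotone_linear_homogeneous])
qed

lemma monotone_linear_vector_class: "monotone_linear F A vector_class"
  unfolding vector_class_def
  by (rule monotone_linear_comp[OF monotone_linear_degree_one monotone_linear_homogeneous])

lemma scalar_class_reflects: "leq A (scalar_class a) (scalar_class b) \<Longrightarrow> a \<le> b"
  using homogeneous_reflects[of 0 "Scal a" "Scal b"] by (simp add: scalar_class_def)

lemma vector_class_reflects:
  assumes "v \<in> carrier F" "w \<in> carrier F" "leq A (vector_class v) (vector_class w)"
  shows "leq F v w"
  using assms monotone_linear.map_closed[OF monotone_linear_degree_one]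
  unfolding vector_class_def
  by (intro degree_one_reflects homogeneous_reflects[of 1]) simp_all

lemma exterior_basis_empty: "exterior_basis Bp eps n {} = scalar_class 1"
  by (simp add: exterior_basis_def Let_def scalar_class_def homogeneous_def tensor_algebra_simps(2))

lemma exterior_basis_singleton:
  assumes "i \<in> {1..n}"
  shows "exterior_basis Bp eps n {i} = vector_class (basis_vec i)"
  using incl_mult_one[OF degree_one_basis_carrier[OF assms]]
  by (simp add: exterior_basis_def Let_def vector_class_def homogeneous_def tensor_gen_eq)

section \<open>Exterior powers\<close>

lemma exterior_pts_0: "exterior_pts Bp eps 0 n = scalar_class ` Bp"
proof -
  interpret s: monotone_linear "base_module Bp" A scalar_class
    by (rule monotone_linear_scalar_class)
  have index: "{I. I \<subseteq> {1..n} \<and> card I = 0} = {{}}"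
    by (auto dest: finite_subset)
  have "finsum A (\<lambda>I. b I \<odot>\<^bsub>A\<^esub> exterior_basis Bp eps n I) {{}} = scalar_class (b {})" for b
    using A.finsum_insert[of "{}" "{}" "\<lambda>I. b I \<odot>\<^bsub>A\<^esub> exterior_basis Bp eps n I"]
      s.map_closed s.map_smult[of 1 "b {}"] by (simp add: exterior_basis_empty A.smult_closed)
  then have "exterior_pts Bp eps 0 n = {scalar_class (b ({} :: nat set)) |b. \<forall>I. b I \<in> Bp}"
    unfolding exterior_pts_def Let_def index by simp
  also have "\<dots> = scalar_class ` Bp"
  proof (intro equalityI subsetI)
    fix x assume "x \<in> scalar_class ` Bp"
    then obtain a where "x = scalar_class a" "a \<in> Bp" by blast
    then show "x \<in> {scalar_class (b ({} :: nat set)) |b. \<forall>I. b I \<in> Bp}"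
      by (intro CollectI exI[of _ "\<lambda>_. a"]) simp
  qed blast
  finally show ?thesis .
qed

lemma vector_class_restrict:
  assumes "finite S" "S \<subseteq> {1..n}"
  shows "finsum A (\<lambda>i. c i \<odot>\<^bsub>A\<^esub> vector_class (basis_vec i)) S
    = vector_class (\<lambda>i. if i \<in> S then c i else 0)"
  using assms
proof (induction S)
  case empty
  show ?case
    using monotone_linear.map_zero[OF monotone_linear_vector_class] by simp
next
  case (insert j S)
  interpret v: monotone_linear F A vector_class by (rule monotone_linear_vector_class)
  let ?w = "\<lambda>i. if i \<in> S then c i else 0"
  have closed: "c i \<odot>\<^bsub>A\<^esub> vector_class (basis_vec i) \<in> carrier A" if "i \<in> {1..n}" for i
    using that by (intro A.smult_closed v.map_closed basis_vec_carrier)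
  have j: "basis_vec j \<in> carrier F" "c j \<odot>\<^bsub>F\<^esub> basis_vec j \<in> carrier F"
    using insert.prems basis_vec_carrier[of j] by auto
  have w: "?w \<in> carrier F" using insert.prems by auto
  have "(\<lambda>i. if i \<in> insert j S then c i else 0) = c j \<odot>\<^bsub>F\<^esub> basis_vec j \<oplus>\<^bsub>F\<^esub> ?w"
    using insert.hyps by (auto simp: basis_vec_def fun_eq_iff)
  then have "vector_class (\<lambda>i. if i \<in> insert j S then c i else 0)
      = c j \<odot>\<^bsub>A\<^esub> vector_class (basis_vec j) \<oplus>\<^bsub>A\<^esub> vector_class ?w"
    using v.map_add[OF j(2) w] v.map_smult[OF j(1)] by (simp only:)
  moreover have "finsum A (\<lambda>i. c i \<odot>\<^bsub>A\<^esub> vector_class (basis_vec i)) (insert j S)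
      = c j \<odot>\<^bsub>A\<^esub> vector_class (basis_vec j)
        \<oplus>\<^bsub>A\<^esub> finsum A (\<lambda>i. c i \<odot>\<^bsub>A\<^esub> vector_class (basis_vec i)) S"
    using insert.hyps insert.prems by (intro A.finsum_insert Pi_I closed) auto
  ultimately show ?case using insert by simp
qed

lemma exterior_pts_1:
  assumes "0 \<in> Bp"
  shows "exterior_pts Bp eps 1 n = vector_class ` pts F"
proof -
  interpret v: monotone_linear F A vector_class by (rule monotone_linear_vector_class)
  have index: "{I. I \<subseteq> {1..n} \<and> card I = 1} = (\<lambda>i. {i}) ` {1..n}"
    by (auto simp: card_1_singleton_iff)
  have sum: "finsum A (\<lambda>I. b I \<odot>\<^bsub>A\<^esub> exterior_basis Bp eps n I) ((\<lambda>i. {i}) ` {1..n})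
      = vector_class (\<lambda>i. if i \<in> {1..n} then b {i} else 0)" for b
  proof -
    have closed: "b {i} \<odot>\<^bsub>A\<^esub> vector_class (basis_vec i) \<in> carrier A" if "i \<in> {1..n}" for i
      using that by (intro A.smult_closed v.map_closed basis_vec_carrier)
    have "finsum A (\<lambda>I. b I \<odot>\<^bsub>A\<^esub> exterior_basis Bp eps n I) ((\<lambda>i. {i}) ` {1..n})
        = finsum A (\<lambda>i. b {i} \<odot>\<^bsub>A\<^esub> exterior_basis Bp eps n {i}) {1..n}"
      using closed by (intro A.finsum_reindex) (auto simp: exterior_basis_singleton)
    also have "\<dots> = finsum A (\<lambda>i. b {i} \<odot>\<^bsub>A\<^esub> vector_class (basis_vec i)) {1..n}"
      using closed by (intro A.finsum_cong') (auto simp: exterior_basis_singleton)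
    finally show ?thesis by (simp add: vector_class_restrict)
  qed
  show ?thesis
  proof (intro equalityI subsetI)
    fix x assume "x \<in> exterior_pts Bp eps 1 n"
    then obtain b where "x = vector_class (\<lambda>i. if i \<in> {1..n} then b {i} else 0)" "\<forall>I. b I \<in> Bp"
      unfolding exterior_pts_def Let_def index sum by blast
    then show "x \<in> vector_class ` pts F" by (intro image_eqI) auto
  next
    fix x assume "x \<in> vector_class ` pts F"
    then obtain w where w: "w \<in> pts F" "x = vector_class w" by blast
    \<comment> \<open>As \<open>w\<close> vanishes outside \<open>{1..n}\<close> and $0 \in B^\bullet$, the coefficients
      \<open>w (the_elem I)\<close> lie in $B^\bullet$ for all sets \<open>I\<close>, singletons or not.\<close>
    have "w i \<in> Bp" for i using w(1) assms by (cases "i \<in> {1..n}") auto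
    moreover have "w = (\<lambda>i. if i \<in> {1..n} then w (the_elem {i}) else 0)"
      using w(1) by auto
    ultimately show "x \<in> exterior_pts Bp eps 1 n"
      unfolding exterior_pts_def Let_def index sum w(2)
      by (intro CollectI exI[of _ "\<lambda>I. w (the_elem I)"] conjI allI arg_cong[of _ _ vector_class]) simp_all
  qed
qed

lemma exterior_pts_large:
  assumes "0 \<in> Bp" "k \<ge> n + 1"
  shows "exterior_pts Bp eps k n = {\<zero>\<^bsub>A\<^esub>}"
proof -
  have "card I \<noteq> k" if "I \<subseteq> {1..n}" for I
    using card_mono[OF finite_atLeastAtMost that] assms(2) by simp
  then have index: "{I. I \<subseteq> {1..n} \<and> card I = k} = {}"
    by blast
  show ?thesis
    unfolding exterior_pts_def Let_def index using assms(1) by (auto intro: exI[of _ "\<lambda>_. 0"])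
qed

lemma exterior_power_eq:
  "exterior_power Bp eps d n
    = A\<lparr>carrier := submodule_span A (exterior_pts Bp eps d n), pts := exterior_pts Bp eps d n\<rparr>"
  by (simp add: exterior_power_def)

lemma exterior_power_0_iso:
  assumes "ordered_blueprint Bp"
  shows "blue_isomorphic Bp (base_module Bp) (exterior_power Bp eps 0 n)"
  unfolding exterior_power_eq
  by (rule blue_isomorphic_span[OF base_module_blue[OF assms] A.ordered_semimodule_axioms
        monotone_linear_scalar_class])
     (simp_all add: scalar_class_reflects exterior_pts_0)

lemma exterior_power_1_iso:
  assumes "ordered_blueprint Bp"
  shows "blue_isomorphic Bp F (exterior_power Bp eps 1 n)"
  unfolding exterior_power_eq exterior_pts_1[OF ordered_blueprint.zero_mem[OF assms]]
  by (rule blue_isomorphic_span[OF free_module_blue[OF assms] A.ordered_semimodule_axioms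
        monotone_linear_vector_class vector_class_reflects HOL.refl])

lemma exterior_power_large_iso:
  assumes "ordered_blueprint Bp" "k \<ge> n + 1"
  shows "blue_isomorphic Bp zero_module (exterior_power Bp eps k n)"
proof -
  have "monotone_linear zero_module A (\<lambda>_. \<zero>\<^bsub>A\<^esub>)"
    by unfold_locales (simp_all add: zero_module_def A.smult_zero A.leq_refl)
  then show ?thesis
    unfolding exterior_power_eq
      exterior_pts_large[OF ordered_blueprint.zero_mem[OF assms(1)] assms(2)]
    by (rule blue_isomorphic_span[OF zero_module_blue[OF assms(1)] A.ordered_semimodule_axioms])
       (simp_all add: zero_module_def)
qed

lemma carrier_exterior_power_1:
  assumes "ordered_blueprint Bp"
  shows "carrier (exterior_power Bp eps 1 n) = homogeneous 1 ` carrier (P 1)"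
proof -
  interpret v: monotone_linear F A vector_class by (rule monotone_linear_vector_class)
  have "carrier (exterior_power Bp eps 1 n) = vector_class ` submodule_span F (pts F)"
    unfolding exterior_power_eq exterior_pts_1[OF ordered_blueprint.zero_mem[OF assms]]
    using v.span_image[OF ordered_semimodule_free, of "pts F"] by auto
  also have "\<dots> = homogeneous 1 ` (degree_one ` carrier F)"
    unfolding blue_module_spanned[OF free_module_blue[OF assms]] vector_class_def image_image ..
  finally show ?thesis unfolding degree_one_surj .
qed

text \<open>
  The class map $T(B^n) \to A_n$ is a surjective homomorphism, so generation in degree one is
  inherited from $T(B^n)$.
\<close>

lemma exterior_algebra_generated:
  assumes "ordered_blueprint Bp"
  shows "carrier (exterior_algebra Bp eps n)
    = subalgebra_span (exterior_algebra Bp eps n) (carrier (exterior_power Bp eps 1 n))"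
proof -
  let ?E = "exterior_algebra Bp eps n"
  let ?G = "homogeneous 1 ` carrier (P 1)"
  have E: "carrier ?E = Q.cls ` carrier T" "\<zero>\<^bsub>?E\<^esub> = Q.cls \<zero>\<^bsub>T\<^esub>" "\<one>\<^bsub>?E\<^esub> = Q.cls \<one>\<^bsub>T\<^esub>"
    "\<And>x y. x \<in> carrier T \<Longrightarrow> y \<in> carrier T \<Longrightarrow> Q.cls x \<oplus>\<^bsub>?E\<^esub> Q.cls y = Q.cls (x \<oplus>\<^bsub>T\<^esub> y)"
    "\<And>x y. x \<in> carrier T \<Longrightarrow> y \<in> carrier T \<Longrightarrow> Q.cls x \<otimes>\<^bsub>?E\<^esub> Q.cls y = Q.cls (x \<otimes>\<^bsub>T\<^esub> y)"
    "\<And>b x. x \<in> carrier T \<Longrightarrow> b \<odot>\<^bsub>?E\<^esub> Q.cls x = Q.cls (b \<odot>\<^bsub>T\<^esub> x)"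
    by (simp_all add: exterior_algebra_def ambient_simps ambient_one ambient_mult)
  have one: "\<one>\<^bsub>T\<^esub> \<in> carrier T" by (simp add: tensor_algebra_simps(2) incl_closed)
  have "Q.cls x \<in> subalgebra_span ?E ?G" if "x \<in> subalgebra_span T (incl 1 ` carrier (P 1))" for x
    using that
  proof induction
    case (incl x)
    then show ?case by (auto simp: homogeneous_def intro: subalgebra_span.incl)
  next
    case zero
    then show ?case by (simp flip: E(2) add: subalgebra_span.zero)
  next
    case one
    then show ?case by (simp flip: E(3) add: subalgebra_span.one)
  next
    case (add x y)
    then show ?case
      using E(4)[of x y] by (metis subalgebra_span.add tensor_algebra_span_closed)
  next
    case (mult x y)
    then show ?case
      using E(5)[of x y] by (metis subalgebra_span.mult tensor_algebra_span_closed)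
  next
    case (smult x b)
    then show ?case
      using E(6)[of x b] by (metis subalgebra_span.smult tensor_algebra_span_closed)
  qed
  moreover have "y \<in> Q.cls ` carrier T" if "y \<in> subalgebra_span ?E ?G" for y
    using that
  proof induction
    case (incl y)
    then show ?case by (auto simp: homogeneous_def incl_closed)
  qed (use one in \<open>auto simp: E T.smult_closed tensor_algebra_mult_closed\<close>)
  ultimately show ?thesis
    unfolding carrier_exterior_power_1[OF assms] E(1) using tensor_algebra_generated by blast
qed

end


theorem theoremA:
  fixes Bp :: "'a::ord_comm_semiring set" and eps :: 'a and n :: nat
  assumes "F1pm_algebra Bp eps"
  shows "blue_isomorphic Bp (base_module Bp) (exterior_power Bp eps 0 n) \<and>
    blue_isomorphic Bp (free_module Bp n) (exterior_power Bp eps 1 n) \<and>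
    (\<forall>k\<ge>n + 1. blue_isomorphic Bp zero_module (exterior_power Bp eps k n)) \<and>
    carrier (exterior_algebra Bp eps n) =
      subalgebra_span (exterior_algebra Bp eps n) (carrier (exterior_power Bp eps 1 n))"
proof -
  interpret exterior Bp n eps .
  have "ordered_blueprint Bp" using assms by (rule F1pm_algebra.axioms(1))
  then show ?thesis
    using exterior_power_0_iso exterior_power_1_iso exterior_power_large_iso
      exterior_algebra_generated by blast
qed

end
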